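(* Let the window $W\subset\mathbb{R}^d$ be given as an intersection of finitely many halfspaces, $W=\{x\mid Ax\leq b\}$ with $A\in\mathbb{R}^{l\times d}$ and $b\in\mathbb{R}^l$, where $d$, $A$ and $b$ are fixed (not part of the input). Then, for any finite set $P\subset\mathbb{R}^d$, the set $\operatorname{Sep}_{W^\circ}(P)$ can be computed with $O(\operatorname{card}(P)^{d+1})$ operations in the real RAM model.
   Context: For $P,W\subset\mathbb{R}^d$ and $t\in\mathbb{R}^d$, let $S_{W,t}(P)=P\cap(t+W)$ and $\operatorname{Sep}_W(P)=\{S_{W,t}(P)\mid t\in\mathbb{R}^d\}$. $W^\circ$ denotes the interior of $W$. The real RAM model counts each elementary operation on real numbers at unit cost. *)

theory Defs
  imports "HOL-Analysis.Analysis"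
begin

definition S_win :: "'a::ab_group_add set \<Rightarrow> 'a \<Rightarrow> 'a set \<Rightarrow> 'a set" where
  "S_win W t P = P \<inter> ((\<lambda>w. t + w) ` W)"

definition Sep :: "'a::ab_group_add set \<Rightarrow> 'a set \<Rightarrow> 'a set set" where
  "Sep W P = {S_win W t P | t. True}"

definition polywin :: "real^'d^'l \<Rightarrow> real^'l \<Rightarrow> (real^'d) set" where
  "polywin A b = {x. \<forall>i. (A *v x) $ i \<le> b $ i}"

text \<open>Two unbounded memories: integer (natural number) registers used for counting and
 addressing, and real registers. Every instruction costs one unit.
 Real operations: constants, +, -, *, /, comparison. Integer operations: constants, +, -,
 comparison. Indirect addressing (loads/stores through integer registers).\<close>

datatype instr =
    IConst nat nat
  | IAdd nat nat nat
  | ISub nat nat nat          (* I[i] := I[j] - I[k] (truncated) *)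
  | ILoad nat nat
  | IStore nat nat
  | RConst nat real
  | RAdd nat nat nat
  | RSub nat nat nat
  | RMul nat nat nat
  | RDiv nat nat nat
  | RLoad nat nat
  | RStore nat nat
  | JmpILess nat nat nat
  | JmpRLess nat nat nat
  | Jmp nat
  | Halt

type_synonym rstate = "nat \<times> (nat \<Rightarrow> nat) \<times> (nat \<Rightarrow> real)"

definition halted :: "instr list \<Rightarrow> rstate \<Rightarrow> bool" where
  "halted prog s = (fst s \<ge> length prog \<or> prog ! fst s = Halt)"

fun exec :: "instr \<Rightarrow> rstate \<Rightarrow> rstate" where
  "exec (IConst i k) (pc, I, R) = (Suc pc, I(i := k), R)"
| "exec (IAdd i j k) (pc, I, R) = (Suc pc, I(i := I j + I k), R)"
| "exec (ISub i j k) (pc, I, R) = (Suc pc, I(i := I j - I k), R)"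
| "exec (ILoad i j) (pc, I, R) = (Suc pc, I(i := I (I j)), R)"
| "exec (IStore i j) (pc, I, R) = (Suc pc, I(I i := I j), R)"
| "exec (RConst i x) (pc, I, R) = (Suc pc, I, R(i := x))"
| "exec (RAdd i j k) (pc, I, R) = (Suc pc, I, R(i := R j + R k))"
| "exec (RSub i j k) (pc, I, R) = (Suc pc, I, R(i := R j - R k))"
| "exec (RMul i j k) (pc, I, R) = (Suc pc, I, R(i := R j * R k))"
| "exec (RDiv i j k) (pc, I, R) = (Suc pc, I, R(i := R j / R k))"
| "exec (RLoad i j) (pc, I, R) = (Suc pc, I, R(i := R (I j)))"
| "exec (RStore i j) (pc, I, R) = (Suc pc, I, R(I i := R j))"
| "exec (JmpILess i j t) (pc, I, R) = ((if I i < I j then t else Suc pc), I, R)"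
| "exec (JmpRLess i j t) (pc, I, R) = ((if R i < R j then t else Suc pc), I, R)"
| "exec (Jmp t) (pc, I, R) = (t, I, R)"
| "exec Halt s = s"

definition step :: "instr list \<Rightarrow> rstate \<Rightarrow> rstate" where
  "step prog s = (if halted prog s then s else exec (prog ! fst s) s)"

text \<open>Input encoding of a list of points ps in R^d, with coordinates enumerated by enc:
 I[0] = number of points, R[k*d + j] = coordinate enc j of point k; everything else 0.\<close>
definition init_state :: "(nat \<Rightarrow> 'd::finite) \<Rightarrow> (real^'d) list \<Rightarrow> rstate" where
  "init_state enc ps =
     (0, (\<lambda>a. if a = 0 then length ps else 0),
      (\<lambda>a. if a < length ps * CARD('d) then ps ! (a div CARD('d)) $ enc (a mod CARD('d)) else 0))"

text \<open>Output decoding: I[1] = m (number of output sets), I[2] = base address; output set k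
 (k < m) is given by its characteristic vector over the input points:
 point ps!i belongs to it iff I[I[2] + k*n + i] \<noteq> 0, where n = length ps.\<close>
definition out_set :: "'a list \<Rightarrow> rstate \<Rightarrow> nat \<Rightarrow> 'a set" where
  "out_set ps s k = (case s of (pc, I, R) \<Rightarrow>
      {ps ! i | i. i < length ps \<and> I (I 2 + k * length ps + i) \<noteq> 0})"

definition out_count :: "rstate \<Rightarrow> nat" where
  "out_count s = (case s of (pc, I, R) \<Rightarrow> I 1)"

definition outputs :: "'a list \<Rightarrow> rstate \<Rightarrow> 'a set set \<Rightarrow> bool" where
  "outputs ps s F =
     ((\<forall>k<out_count s. \<forall>k'<out_count s. k \<noteq> k' \<longrightarrow> out_set ps s k \<noteq> out_set ps s k')
      \<and> out_set ps s ` {..<out_count s} = F)"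

end

theory Submission
  imports Defs
begin

text \<open>A point \<open>p\<close> lies in \<open>t + W\<^sup>\<circ>\<close> iff \<open>a j \<bullet> t > a j \<bullet> p - b j\<close> for all rows \<open>j\<close>, so the sets to be
  computed correspond to the faces of an arrangement of hyperplanes with fixed normals \<open>a j\<close>.
  Moving \<open>t\<close> inside the closure of its face leads to a point \<open>v\<close> at which the normals of the tight
  hyperplanes span the row space. Then \<open>v\<close> is determined by a basis of the rows and at most \<open>d\<close>
  points of \<open>P\<close>, and \<open>t\<close> can be replaced by \<open>v\<close> plus an infinitesimal displacement, of which only
  the signs of the products with the normals matter. This leaves constantly many choices for each of
  the \<open>n^d\<close> tuples of points. Each candidate is a word of \<open>n\<close> bits, each bit costs constant time, and
  duplicates are recognised by inserting the words into a trie while they are computed.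

  The machine programs are obtained from structured programs by a verified compiler, with
  a weakest precondition calculus that keeps track of the running time.\<close>

section \<open>Structured programs for the real RAM\<close>

text \<open>Only O(n) steps are available per tuple of points, and this shapes the construction.
  Candidates need no feasibility test: the sign patterns are those of actual displacements, and a
  vector with prescribed products with independent normals always exists, so every tuple, whether or
  not it comes from a face, yields a set cut out by some translate. All linear algebra depends on
  \<open>A\<close> and \<open>b\<close> alone, so bases, coefficients and sign patterns become
  constants of a program that is only shown to exist. If the rows do not span the whole space, the
  arrangement has no vertices; bases of the row space, possibly shorter than d, take their place.
  Comparing a word with all earlier ones would be too slow, whereas a trie costs constant time per
  bit.\<close>

type_synonym mem = "(nat \<Rightarrow> nat) \<times> (nat \<Rightarrow> real)"

datatype cond = ILess nat nat | RLess nat nat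

fun holds :: "cond \<Rightarrow> mem \<Rightarrow> bool" where
  "holds (ILess i j) (I, R) = (I i < I j)"
| "holds (RLess i j) (I, R) = (R i < R j)"

fun jump :: "cond \<Rightarrow> nat \<Rightarrow> instr" where
  "jump (ILess i j) t = JmpILess i j t"
| "jump (RLess i j) t = JmpRLess i j t"

fun straight :: "instr \<Rightarrow> bool" where
  "straight (JmpILess _ _ _) = False"
| "straight (JmpRLess _ _ _) = False"
| "straight (Jmp _) = False"
| "straight Halt = False"
| "straight _ = True"

definition eff :: "instr \<Rightarrow> mem \<Rightarrow> mem" where
  "eff i m = snd (exec i (0, m))"

lemma eff_simps [simp]:
  "eff (IConst i k) (I, R) = (I(i := k), R)"
  "eff (IAdd i j k) (I, R) = (I(i := I j + I k), R)"
  "eff (ISub i j k) (I, R) = (I(i := I j - I k), R)"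
  "eff (ILoad i j) (I, R) = (I(i := I (I j)), R)"
  "eff (IStore i j) (I, R) = (I(I i := I j), R)"
  "eff (RConst i x) (I, R) = (I, R(i := x))"
  "eff (RAdd i j k) (I, R) = (I, R(i := R j + R k))"
  "eff (RSub i j k) (I, R) = (I, R(i := R j - R k))"
  "eff (RMul i j k) (I, R) = (I, R(i := R j * R k))"
  "eff (RDiv i j k) (I, R) = (I, R(i := R j / R k))"
  "eff (RLoad i j) (I, R) = (I, R(i := R (I j)))"
  "eff (RStore i j) (I, R) = (I, R(I i := R j))"
  by (simp_all add: eff_def)

lemma exec_straight: "straight i \<Longrightarrow> exec i (p, m) = (Suc p, eff i m)"
  by (cases i; cases m) auto

section \<open>Timed semantics and compilation of structured programs\<close>

datatype com = Block "instr list" | Seq com com | Cond cond com com | While cond com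

text \<open>The costs are the exact step counts of the compiled code: a false conditional pays an
  extra jump over the other branch, each pass of a loop pays the test and the jump back, and leaving
  a loop pays the failed test and the exit jump.\<close>

inductive big :: "com \<Rightarrow> mem \<Rightarrow> mem \<Rightarrow> nat \<Rightarrow> bool" where
  block: "\<forall>i\<in>set is. straight i \<Longrightarrow> big (Block is) m (fold eff is m) (length is)"
| seq: "big a m m1 t \<Longrightarrow> big b m1 m2 u \<Longrightarrow> big (Seq a b) m m2 (t + u)"
| cond_true: "holds c m \<Longrightarrow> big a m m1 t \<Longrightarrow> big (Cond c a b) m m1 (1 + t)"
| cond_false: "\<not> holds c m \<Longrightarrow> big b m m1 t \<Longrightarrow> big (Cond c a b) m m1 (1 + (t + 1))"
| while_true: "holds c m \<Longrightarrow> big a m m1 t \<Longrightarrow> big (While c a) m1 m2 u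
    \<Longrightarrow> big (While c a) m m2 (1 + (t + (1 + u)))"
| while_false: "\<not> holds c m \<Longrightarrow> big (While c a) m m (1 + 1)"

text \<open>Jump targets are absolute, hence the start address \<open>p\<close>. A conditional jump
  is taken when its condition holds, so the else branch comes first in the code.\<close>

fun compile :: "nat \<Rightarrow> com \<Rightarrow> instr list" where
  "compile p (Block is) = is"
| "compile p (Seq a b) = (let x = compile p a in x @ compile (p + length x) b)"
| "compile p (Cond c a b) = (let y = compile (p + 1) b; q = p + 2 + length y; x = compile q a
     in jump c q # y @ Jmp (q + length x) # x)"
| "compile p (While c a) = (let x = compile (p + 2) a
     in jump c (p + 2) # Jmp (p + 3 + length x) # x @ [Jmp p])"

definition runs :: "instr list \<Rightarrow> nat \<Rightarrow> mem \<Rightarrow> nat \<Rightarrow> nat \<Rightarrow> mem \<Rightarrow> bool" where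
  "runs prog p m t p' m' \<longleftrightarrow> (step prog ^^ t) (p, m) = (p', m')"

lemma runs_trans: "runs prog p m t p1 m1 \<Longrightarrow> runs prog p1 m1 u p2 m2 \<Longrightarrow> runs prog p m (t + u) p2 m2"
  unfolding runs_def by (simp add: add.commute[of t u] funpow_add)

lemma runs_refl: "runs prog p m 0 p m"
  by (simp add: runs_def)

lemma runs_straight:
  "p < length prog \<Longrightarrow> straight (prog ! p) \<Longrightarrow> runs prog p m 1 (Suc p) (eff (prog ! p) m)"
  unfolding runs_def by (auto simp: step_def halted_def exec_straight)

lemma runs_jump:
  "p < length prog \<Longrightarrow> prog ! p = jump c t \<Longrightarrow> runs prog p m 1 (if holds c m then t else Suc p) m"
  unfolding runs_def by (cases c; cases m) (auto simp: step_def halted_def)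

lemma runs_Jmp:
  "p < length prog \<Longrightarrow> prog ! p = Jmp t \<Longrightarrow> runs prog p m 1 t m"
  unfolding runs_def by (cases m) (auto simp: step_def halted_def)

lemma runs_block:
  "\<forall>i\<in>set is. straight i \<Longrightarrow>
   runs (pre @ is @ post) (length pre) m (length is) (length pre + length is) (fold eff is m)"
proof (induction "is" arbitrary: pre m)
  case Nil
  then show ?case by (simp add: runs_refl)
next
  case (Cons i js)
  have 1: "runs (pre @ (i # js) @ post) (length pre) m 1 (Suc (length pre)) (eff i m)"
    using runs_straight[of "length pre" "pre @ (i # js) @ post" m] Cons.prems by (simp add: nth_append)
  have 2: "runs ((pre @ [i]) @ js @ post) (length (pre @ [i])) (eff i m) (length js)
      (length (pre @ [i]) + length js) (fold eff js (eff i m))"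
    by (rule Cons.IH) (use Cons.prems in auto)
  show ?case using runs_trans[OF 1] 2 by simp
qed

text \<open>Arbitrary \<open>pre\<close> and \<open>post\<close> let the induction hypotheses speak
  of subprograms inside the surrounding code, and \<open>length pre\<close> is the address at which
  that code really sits.\<close>

lemma compile_correct:
  "big c m m' t \<Longrightarrow> runs (pre @ compile (length pre) c @ post) (length pre) m t
     (length pre + length (compile (length pre) c)) m'"
proof (induction arbitrary: pre post rule: big.induct)
  case (block "is" m)
  then show ?case by (simp add: runs_block)
next
  case (seq a m m1 t b m2 u)
  let ?x = "compile (length pre) a"
  let ?y = "compile (length (pre @ ?x)) b"
  have 1: "runs (pre @ ?x @ (?y @ post)) (length pre) m t (length pre + length ?x) m1"
    by (rule seq.IH(1))
  have 2: "runs ((pre @ ?x) @ ?y @ post) (length (pre @ ?x)) m1 u (length (pre @ ?x) + length ?y) m2"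
    by (rule seq.IH(2))
  show ?case using runs_trans[OF 1] 2 by (simp add: Let_def add.assoc)
next
  case (cond_true c m a m1 t b)
  let ?y = "compile (length pre + 1) b"
  let ?q = "length pre + 2 + length ?y"
  let ?x = "compile ?q a"
  let ?j = "Jmp (?q + length ?x)"
  let ?pr = "pre @ jump c ?q # ?y @ [?j]"
  let ?prog = "pre @ (jump c ?q # ?y @ ?j # ?x) @ post"
  have 1: "runs ?prog (length pre) m 1 ?q m"
    using runs_jump[of "length pre" ?prog c ?q m] cond_true.hyps by (simp add: nth_append)
  have 2: "runs (?pr @ compile (length ?pr) a @ post) (length ?pr) m t (length ?pr + length (compile (length ?pr) a)) m1"
    by (rule cond_true.IH)
  show ?case using runs_trans[OF 1] 2 by (simp add: Let_def add.assoc)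
next
  case (cond_false c m b m1 t a)
  let ?y = "compile (length pre + 1) b"
  let ?q = "length pre + 2 + length ?y"
  let ?x = "compile ?q a"
  let ?j = "Jmp (?q + length ?x)"
  let ?pr = "pre @ [jump c ?q]"
  let ?prog = "pre @ (jump c ?q # ?y @ ?j # ?x) @ post"
  have 1: "runs ?prog (length pre) m 1 (length pre + 1) m"
    using runs_jump[of "length pre" ?prog c ?q m] cond_false.hyps by (simp add: nth_append)
  have 2: "runs (?pr @ compile (length ?pr) b @ (?j # ?x @ post)) (length ?pr) m t (length ?pr + length (compile (length ?pr) b)) m1"
    by (rule cond_false.IH)
  have 3: "runs ?prog (length pre + 1 + length ?y) m1 1 (?q + length ?x) m1"
    by (rule runs_Jmp) (simp_all add: nth_append)
  show ?case using runs_trans[OF 1 runs_trans[OF _ 3]] 2 by (simp add: Let_def add.assoc)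
next
  case (while_true c m a m1 t m2 u)
  let ?x = "compile (length pre + 2) a"
  let ?e = "Jmp (length pre + 3 + length ?x)"
  let ?pr = "pre @ [jump c (length pre + 2), ?e]"
  let ?prog = "pre @ (jump c (length pre + 2) # ?e # ?x @ [Jmp (length pre)]) @ post"
  have 1: "runs ?prog (length pre) m 1 (length pre + 2) m"
    using runs_jump[of "length pre" ?prog c "length pre + 2" m] while_true.hyps by (simp add: nth_append)
  have 2: "runs (?pr @ compile (length ?pr) a @ (Jmp (length pre) # post)) (length ?pr) m t (length ?pr + length (compile (length ?pr) a)) m1"
    by (rule while_true.IH)
  have 3: "runs ?prog (length pre + 2 + length ?x) m1 1 (length pre) m1"
    by (rule runs_Jmp) (simp_all add: nth_append)
  have 4: "runs ?prog (length pre) m1 u (length pre + length (compile (length pre) (While c a))) m2"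
    using while_true.IH(2)[of pre post] by (simp add: Let_def)
  show ?case using runs_trans[OF 1 runs_trans[OF _ runs_trans[OF 3 4]]] 2 by (simp add: Let_def add.assoc)
next
  case (while_false c m a)
  let ?x = "compile (length pre + 2) a"
  let ?e = "Jmp (length pre + 3 + length ?x)"
  let ?prog = "pre @ (jump c (length pre + 2) # ?e # ?x @ [Jmp (length pre)]) @ post"
  have 1: "runs ?prog (length pre) m 1 (length pre + 1) m"
    using runs_jump[of "length pre" ?prog c "length pre + 2" m] while_false.hyps by (simp add: nth_append)
  have 2: "runs ?prog (length pre + 1) m 1 (length pre + 3 + length ?x) m"
    by (rule runs_Jmp) (simp_all add: nth_append)
  show ?case using runs_trans[OF 1 2] by (simp add: Let_def numeral_3_eq_3)
qed

section \<open>Total correctness with an upper bound on the running time\<close>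

definition wp :: "com \<Rightarrow> mem \<Rightarrow> nat \<Rightarrow> (mem \<Rightarrow> bool) \<Rightarrow> bool" where
  "wp c m t Q \<longleftrightarrow> (\<exists>m' u. big c m m' u \<and> u \<le> t \<and> Q m')"

lemma wp_mono: "wp c m t Q \<Longrightarrow> t \<le> t' \<Longrightarrow> (\<And>m. Q m \<Longrightarrow> Q' m) \<Longrightarrow> wp c m t' Q'"
  unfolding wp_def by (elim exE conjE, intro exI conjI, assumption) auto

lemma wp_block: "\<forall>i\<in>set is. straight i \<Longrightarrow> Q (fold eff is m) \<Longrightarrow> wp (Block is) m (length is) Q"
  unfolding wp_def by (intro exI conjI, erule block) auto

lemma wp_seq: "wp a m t (\<lambda>m. wp b m u Q) \<Longrightarrow> wp (Seq a b) m (t + u) Q"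
  unfolding wp_def by (elim exE conjE, intro exI conjI, erule (1) seq) auto

lemma wp_cond:
  assumes "holds c m \<Longrightarrow> wp a m t Q" "\<not> holds c m \<Longrightarrow> wp b m t Q"
  shows "wp (Cond c a b) m (t + 2) Q"
proof (cases "holds c m")
  case True
  then obtain m' u where "big a m m' u" "u \<le> t" "Q m'"
    using assms unfolding wp_def by blast
  then show ?thesis using cond_true[OF True, of a m' u b] unfolding wp_def
    by (intro exI[of _ m'] exI[of _ "1 + u"]) auto
next
  case False
  then obtain m' u where "big b m m' u" "u \<le> t" "Q m'"
    using assms unfolding wp_def by blast
  then show ?thesis using cond_false[OF False, of b m' u a] unfolding wp_def
    by (intro exI[of _ m'] exI[of _ "1 + (u + 1)"]) auto
qed

text \<open>All loops used here are counting loops, so the number \<open>N\<close> of passes is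
  known beforehand and indexes the invariant. A pass costs 2 for the test and the jump back; the
  final 2 are the failed test and the exit jump.\<close>

lemma wp_loop:
  assumes "\<And>k m. k < N \<Longrightarrow> Inv k m \<Longrightarrow> holds c m \<and> wp a m t (Inv (Suc k))"
    and "\<And>m. Inv N m \<Longrightarrow> \<not> holds c m"
    and "Inv 0 m"
  shows "wp (While c a) m (N * (t + 2) + 2) (Inv N)"
proof -
  have "wp (While c a) m (j * (t + 2) + 2) (Inv N)" if "j \<le> N" "Inv (N - j) m" for j m
    using that
  proof (induction j arbitrary: m)
    case 0
    then show ?case using assms(2)[of m] unfolding wp_def
      by (intro exI[of _ m] exI[of _ "1 + 1"] conjI while_false) auto
  next
    case (Suc j)
    then have *: "N - Suc j < N" "Suc (N - Suc j) = N - j" by auto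
    obtain m1 u1 where 1: "holds c m" "big a m m1 u1" "u1 \<le> t" "Inv (N - j) m1"
      using assms(1)[OF *(1) Suc.prems(2)] * unfolding wp_def by auto
    obtain m2 u2 where 2: "big (While c a) m1 m2 u2" "u2 \<le> j * (t + 2) + 2" "Inv N m2"
      using Suc.IH[OF _ 1(4)] Suc.prems(1) unfolding wp_def by auto
    show ?case using while_true[OF 1(1,2) 2(1)] 1 2 unfolding wp_def
      by (intro exI[of _ m2] exI[of _ "1 + (u1 + (1 + u2))"]) auto
  qed
  from this[of N m] assms(3) show ?thesis by simp
qed

lemma wp_run:
  assumes "wp c m t Q"
  shows "\<exists>u m'. u \<le> t \<and> (step (compile 0 c) ^^ u) (0, m) = (length (compile 0 c), m') \<and> Q m'"
proof -
  obtain m' u where *: "big c m m' u" "u \<le> t" "Q m'"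
    using assms unfolding wp_def by blast
  then show ?thesis
    using compile_correct[OF *(1), of "[]" "[]"] unfolding runs_def
    by (intro exI[of _ u] exI[of _ m']) auto
qed

lemma wp_blockI:
  "\<forall>i\<in>set is. straight i \<Longrightarrow> length is \<le> t \<Longrightarrow> Q (fold eff is m) \<Longrightarrow> wp (Block is) m t Q"
  using wp_mono[OF wp_block] by blast

section \<open>Tries\<close>

text \<open>The nodes are the words of the prefix-closed set \<open>S\<close>. The node of \<open>w\<close> occupies the two cells
  from \<open>\<nu> w\<close> on, which hold the addresses of its children, or 0. Free cells below \<open>E\<close> are 0.\<close>

definition trie :: "nat \<Rightarrow> nat \<Rightarrow> bool list set \<Rightarrow> (bool list \<Rightarrow> nat) \<Rightarrow> (nat \<Rightarrow> nat) \<Rightarrow> bool" where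
  "trie T E S \<nu> I \<longleftrightarrow> finite S \<and> [] \<in> S \<and> (\<forall>w b. w @ [b] \<in> S \<longrightarrow> w \<in> S) \<and> \<nu> [] = T \<and> inj_on \<nu> S
    \<and> (\<forall>w\<in>S. \<exists>k<card S. \<nu> w = T + 2 * k)
    \<and> (\<forall>w\<in>S. \<forall>b. I (\<nu> w + of_bool b) = (if w @ [b] \<in> S then \<nu> (w @ [b]) else 0))
    \<and> (\<forall>a. T + 2 * card S \<le> a \<and> a < E \<longrightarrow> I a = 0)"

lemma trie_node_bounds:
  assumes "trie T E S \<nu> I" "w \<in> S"
  shows "T \<le> \<nu> w" "\<nu> w + of_bool b < T + 2 * card S"
proof -
  obtain k where "k < card S" "\<nu> w = T + 2 * k"
    using assms unfolding trie_def by blast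
  then show "T \<le> \<nu> w" "\<nu> w + of_bool b < T + 2 * card S"
    by (cases b; simp)+
qed

text \<open>Node addresses differ from \<open>T\<close> by even numbers, so the parity of a cell
  determines the bit and then the node.\<close>

lemma trie_node_inj:
  assumes "trie T E S \<nu> I" "w \<in> S" "u \<in> S" "\<nu> w + of_bool b = \<nu> u + of_bool c"
  shows "w = u \<and> b = c"
proof -
  obtain k j where kj: "\<nu> w = T + 2 * k" "\<nu> u = T + 2 * j"
    using assms unfolding trie_def by blast
  then have "k = j \<and> b = c"
    using assms(4) by (cases b; cases c; simp; presburger)
  then show ?thesis
    using assms kj unfolding trie_def inj_on_def by auto
qed

text \<open>Frame rule: writes to the registers below \<open>T\<close> and to the output from
  \<open>E\<close> on leave the trie intact.\<close>

lemma trie_cong: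
  assumes "trie T E S \<nu> I" "\<And>a. T \<le> a \<Longrightarrow> a < E \<Longrightarrow> I' a = I a" "T + 2 * card S \<le> E"
  shows "trie T E S \<nu> I'"
proof -
  have "I' (\<nu> w + of_bool b) = I (\<nu> w + of_bool b)" if "w \<in> S" for w b
    using trie_node_bounds(1)[OF assms(1) that] trie_node_bounds(2)[OF assms(1) that, of b] assms(3) by (intro assms(2)) auto
  moreover have "I' a = 0" if "T + 2 * card S \<le> a" "a < E" for a
    using assms(1) assms(2)[of a] that unfolding trie_def by auto
  ultimately show ?thesis
    using assms(1) unfolding trie_def by simp
qed

text \<open>The new node takes the first free address. Its two cells are still 0, which already
  encodes a leaf, so only the cell of the parent is written.\<close>

lemma trie_insert:
  assumes t: "trie T E S \<nu> I" and w: "w \<in> S" "w @ [b] \<notin> S" and E: "T + 2 * card S + 2 \<le> E"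
    and I': "\<And>a. T \<le> a \<Longrightarrow> a < E \<Longrightarrow> I' a = (I(\<nu> w + of_bool b := T + 2 * card S)) a"
  shows "trie T E (insert (w @ [b]) S) (\<nu>(w @ [b] := T + 2 * card S)) I'"
proof -
  let ?S = "insert (w @ [b]) S"
  let ?v = "\<nu>(w @ [b] := T + 2 * card S)"
  have fin: "finite S" and nil: "[] \<in> S" "\<nu> [] = T" and pc: "\<And>w b. w @ [b] \<in> S \<Longrightarrow> w \<in> S"
    and inj: "inj_on \<nu> S" and sp: "\<And>u. u \<in> S \<Longrightarrow> \<exists>k<card S. \<nu> u = T + 2 * k"
    and ch: "\<And>u c. u \<in> S \<Longrightarrow> I (\<nu> u + of_bool c) = (if u @ [c] \<in> S then \<nu> (u @ [c]) else 0)"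
    and ze: "\<And>a. T + 2 * card S \<le> a \<Longrightarrow> a < E \<Longrightarrow> I a = 0"
    using t unfolding trie_def by blast+
  have card: "card ?S = Suc (card S)" using fin w by simp
  have "inj_on ?v ?S"
  proof -
    have "T + 2 * card S \<noteq> \<nu> u" if "u \<in> S" for u
      using sp[OF that] by auto
    then have "inj_on ?v S" "?v (w @ [b]) \<notin> ?v ` (S - {w @ [b]})"
      using inj w by (auto simp: inj_on_def)
    then show ?thesis by (simp add: inj_on_insert)
  qed
  moreover have "\<forall>u\<in>?S. \<exists>k<card ?S. ?v u = T + 2 * k"
    using sp card by (auto intro: less_SucI)
  moreover have "I' (?v u + of_bool c) = (if u @ [c] \<in> ?S then ?v (u @ [c]) else 0)" if "u \<in> ?S" for u c
  proof (cases "u = w @ [b]")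
    case True
    \<comment> \<open>By prefix closure a child in \<open>S\<close> would have forced
      \<open>w @ [b]\<close> into \<open>S\<close>.\<close>
    have "u @ [c] \<notin> ?S" using True pc w by auto
    moreover have "I' (?v u + of_bool c) = 0"
    proof -
      have "\<nu> w + of_bool b < T + 2 * card S" by (rule trie_node_bounds(2)[OF t w(1)])
      then show ?thesis using True E ze[of "T + 2 * card S + of_bool c"]
        by (subst I') (cases c; simp)+
    qed
    ultimately show ?thesis by (simp only: if_False)
  next
    case False
    then have u: "u \<in> S" and vu: "?v u = \<nu> u" using that by simp_all
    note tb = trie_node_bounds(1)[OF t u] trie_node_bounds(2)[OF t u, of c]
    have "I' (\<nu> u + of_bool c) = (if u = w \<and> c = b then T + 2 * card S else I (\<nu> u + of_bool c))"
    proof -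
      have "\<nu> u + of_bool c = \<nu> w + of_bool b \<longleftrightarrow> u = w \<and> c = b"
        using trie_node_inj[OF t u w(1), of c b] by blast
      moreover have "T \<le> \<nu> u + of_bool c" "\<nu> u + of_bool c < E" using tb E by linarith+
      ultimately show ?thesis by (subst I') (simp_all only: fun_upd_apply)
    qed
    also have "\<dots> = (if u @ [c] \<in> ?S then ?v (u @ [c]) else 0)"
      using ch[OF u, of c] w by simp
    finally show ?thesis unfolding vu .
  qed
  moreover have "I' a = 0" if "T + 2 * card ?S \<le> a" "a < E" for a
    using that card ze[of a] trie_node_bounds(2)[OF t w(1), of b] by (subst I') auto
  moreover have "\<forall>u c. u @ [c] \<in> ?S \<longrightarrow> u \<in> ?S" using pc w by auto
  ultimately show ?thesis
    using fin nil w unfolding trie_def by auto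
qed

section \<open>Prefixes of words of equal length\<close>

definition pref :: "'a list set \<Rightarrow> 'a list set" where
  "pref F = insert [] {take i w | i w. w \<in> F}"

lemma pref_insert: "pref (insert w F) = pref F \<union> {take i w | i. True}"
  unfolding pref_def by auto

lemma pref_mono: "F \<subseteq> G \<Longrightarrow> pref F \<subseteq> pref G"
  unfolding pref_def by auto

text \<open>Nonempty prefixes have the form \<open>take (Suc i) w\<close> with \<open>i < n\<close>,
  so a word contributes at most \<open>n\<close> nodes besides the root.\<close>

lemma pref_subset:
  assumes "\<And>w. w \<in> F \<Longrightarrow> length w = n"
  shows "pref F \<subseteq> insert [] ((\<lambda>(w, i). take (Suc i) w) ` (F \<times> {..<n}))"
proof
  fix v assume "v \<in> pref F"
  then consider "v = []" | i w where "v = take i w" "w \<in> F" "i > 0" "w \<noteq> []"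
    unfolding pref_def by fastforce
  then show "v \<in> insert [] ((\<lambda>(w, i). take (Suc i) w) ` (F \<times> {..<n}))"
  proof cases
    case (2 i w)
    then have "v = (\<lambda>(w, i). take (Suc i) w) (w, min i n - 1)" "(w, min i n - 1) \<in> F \<times> {..<n}"
      using assms[OF 2(2)] 2 by (auto simp: min_def)
    then show ?thesis by blast
  qed simp
qed

lemma finite_pref: "finite F \<Longrightarrow> (\<And>w. w \<in> F \<Longrightarrow> length w = n) \<Longrightarrow> finite (pref F)"
  by (rule finite_subset[OF pref_subset]) auto

lemma card_pref:
  assumes "finite F" "\<And>w. w \<in> F \<Longrightarrow> length w = n"
  shows "card (pref F) \<le> 1 + card F * n"
proof -
  let ?B = "(\<lambda>(w, i). take (Suc i) w) ` (F \<times> {..<n})"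
  have "card (pref F) \<le> card (insert [] ?B)"
    using pref_subset assms by (intro card_mono) auto
  also have "\<dots> \<le> 1 + card ?B" using assms(1) by (simp add: card_insert_if)
  also have "card ?B \<le> card F * n"
    using card_image_le[of "F \<times> {..<n}" "\<lambda>(w, i). take (Suc i) w"] assms by (simp add: card_cartesian_product)
  finally show ?thesis by simp
qed

text \<open>A word of the common length can only be a prefix of itself; \<open>n > 0\<close> enters
  because \<open>[]\<close> is always in \<open>pref F\<close>, as the root. This is why a word is
  new exactly if its last trie node is.\<close>

lemma mem_pref_iff:
  assumes "\<And>w. w \<in> F \<Longrightarrow> length w = n" "length w = n" "n > 0"
  shows "w \<in> pref F \<longleftrightarrow> w \<in> F"
proof
  assume "w \<in> pref F"
  then obtain i v where "w = take i v" "v \<in> F"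
    using assms(2,3) unfolding pref_def by auto
  then show "w \<in> F" using assms(1)[of v] assms(2) by simp
next
  assume "w \<in> F"
  then have "take n w \<in> pref F" unfolding pref_def by blast
  then show "w \<in> pref F" using assms(2) by simp
qed

lemma pref_closed:
  assumes "v @ u \<in> pref F"
  shows "v \<in> pref F"
proof (cases "v = []")
  case False
  then obtain i w where w: "v @ u = take i w" "w \<in> F"
    using assms unfolding pref_def by auto
  have "v = take (length v) (v @ u)" by simp
  also have "\<dots> = take (min (length v) i) w" by (simp only: w take_take)
  finally show ?thesis using w(2) unfolding pref_def by blast
qed (simp add: pref_def)

section \<open>The enumeration program\<close>

text \<open>In \<open>sat x cn\<close>, \<open>x k c\<close> is coordinate \<open>c\<close> of the \<open>k\<close>-th of \<open>D + 1\<close> points, the last of which is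
  the point that is tested for membership.\<close>

type_synonym constraint = "real \<times> (nat \<times> nat \<times> real) list \<times> bool"

fun sat :: "(nat \<Rightarrow> nat \<Rightarrow> real) \<Rightarrow> constraint \<Rightarrow> bool" where
  "sat x (c0, ts, s) = (let v = c0 + (\<Sum>(k, c, a)\<leftarrow>ts. a * x k c) in if s then 0 < v else 0 \<le> v)"

definition valid :: "nat \<Rightarrow> constraint \<Rightarrow> bool" where
  "valid D cn \<longleftrightarrow> (\<forall>(k, c, a)\<in>set (fst (snd cn)). k \<le> D \<and> c < D)"

text \<open>Integer registers: 0 number \<open>n\<close> of points, 1 number of output rows, 2 first output row, 7 and 8
  first and last+1 address of the point coordinates, 9 first free trie cell, 10 current trie node,
  11 flag for a new word, 12 next output cell, 13 current bit, 14 and 15 scratch, 16 current output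
  row, \<open>17 + k\<close> address of the \<open>k\<close>-th point of the tuple; the trie starts at \<open>18 + D\<close>. Real registers
  0, 1 and 2 are scratch.\<close>

definition term_code :: "nat \<times> nat \<times> real \<Rightarrow> instr list" where
  "term_code = (\<lambda>(k, c, a). [IConst 14 c, IAdd 14 14 (17 + k), RLoad 1 14, RConst 2 a, RMul 1 1 2, RAdd 0 0 1])"

fun seqs :: "com list \<Rightarrow> com" where
  "seqs [] = Block []"
| "seqs (c # cs) = Seq c (seqs cs)"

text \<open>Register 13 starts at 1 and is cleared by any violated constraint. The machine compares
  strictly only, so \<open>0 \<le> v\<close> is tested through its negation.\<close>

fun con_code :: "constraint \<Rightarrow> com" where
  "con_code (c0, ts, s) = Seq (Block (RConst 0 c0 # concat (map term_code ts) @ [RConst 1 0]))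
     (if s then Cond (RLess 1 0) (Block []) (Block [IConst 13 0])
      else Cond (RLess 0 1) (Block [IConst 13 0]) (Block []))"

definition bits :: "constraint list \<Rightarrow> com" where
  "bits cfg = Seq (Block [IConst 13 1]) (seqs (map con_code cfg))"

fun con_time :: "constraint \<Rightarrow> nat" where
  "con_time (c0, ts, s) = 6 * length ts + 5"

definition bits_time :: "constraint list \<Rightarrow> nat" where
  "bits_time cfg = 1 + sum_list (map con_time cfg)"

text \<open>Node address plus bit is the cell of the wanted child. A 0 in it means that the child is
  missing; then the free address from register 9 is entered and the flag raised, after which both
  cases descend alike.\<close>

definition walk_step :: "nat \<Rightarrow> constraint list \<Rightarrow> com" where
  "walk_step D cfg = Seq (bits cfg) (Seq
     (Block [IStore 12 13, IConst 14 1, IAdd 12 12 14, IAdd 10 10 13, ILoad 15 10, IConst 14 0]) (Seq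
     (Cond (ILess 14 15) (Block []) (Block [IStore 10 9, IConst 14 2, IAdd 9 9 14, IConst 11 1]))
     (Block [ILoad 10 10, IConst 14 D, IAdd (17 + D) (17 + D) 14])))"

text \<open>The word goes into the row behind the accepted ones while the trie is descended. Only if
  a node was created do registers 1 and 16 advance; otherwise the next candidate overwrites the
  row.\<close>

definition walk :: "nat \<Rightarrow> constraint list \<Rightarrow> com" where
  "walk D cfg = Seq (Block [IConst 10 (18 + D), IConst 11 0, IConst 14 0, IAdd 12 16 14, IAdd (17 + D) 7 14]) (Seq
     (While (ILess (17 + D) 8) (walk_step D cfg)) (Seq
     (Block [IConst 14 0])
     (Cond (ILess 14 11) (Block [IConst 14 1, IAdd 1 1 14, IAdd 16 16 0]) (Block []))))"

text \<open>Loop registers hold coordinate addresses advanced by \<open>D\<close> instead of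
  indices, which avoids multiplication. Adding register 14 after setting it to 0 is a register
  copy.\<close>

fun nest :: "nat \<Rightarrow> com \<Rightarrow> nat \<Rightarrow> com" where
  "nest D c 0 = c"
| "nest D c (Suc k) = Seq (Block [IConst 14 0, IAdd (17 + k) 7 14])
     (While (ILess (17 + k) 8) (Seq (nest D c k) (Block [IConst 14 D, IAdd (17 + k) (17 + k) 14])))"

definition mul_n :: com where
  "mul_n = Seq (Block [IConst 15 0, IConst 10 0]) (Seq
     (While (ILess 10 0) (Block [IAdd 15 15 16, IConst 14 1, IAdd 10 10 14]))
     (Block [IConst 14 0, IAdd 16 15 14]))"

text \<open>The coordinates of the input start at real register 0 and have to be moved before the scratch
  registers can be used; the first three are saved without the help of a scratch register.\<close>

definition copy_points :: "nat \<Rightarrow> com" where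
  "copy_points D = Seq
     (Block (replicate D (IAdd 8 8 0) @ [IConst 14 3, IAdd 7 8 14, RStore 7 0, IConst 14 1, IAdd 15 7 14,
        RStore 15 1, IAdd 15 15 14, RStore 15 2, IAdd 15 15 14, IConst 10 3]))
     (While (ILess 10 8) (Block [RLoad 0 10, RStore 15 0, IConst 14 1, IAdd 10 10 14, IAdd 15 15 14]))"

text \<open>Starting from \<open>2 * K\<close>, the \<open>D + 1\<close> multiplications by
  \<open>n\<close> give room for the trie. The offset \<open>20 + D\<close> is also the first free
  trie cell: the root at \<open>18 + D\<close> takes two cells, both already 0.\<close>

definition setup_code :: "nat \<Rightarrow> nat \<Rightarrow> com" where
  "setup_code D K = Seq (copy_points D) (Seq (Block [IAdd 8 7 8, IConst 16 (2 * K)]) (Seq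
     (seqs (replicate (D + 1) mul_n))
     (Block [IConst 14 (20 + D), IAdd 16 16 14, IConst 9 (20 + D), IConst 14 0, IAdd 2 16 14])))"

text \<open>Register 14 is still 0, so the test asks whether the input is nonempty. For empty input
  a single row of length 0 represents the empty set.\<close>

definition main_code :: "nat \<Rightarrow> constraint list list \<Rightarrow> com" where
  "main_code D cfgs = Cond (ILess 14 0)
     (Seq (setup_code D (length cfgs)) (nest D (seqs (map (walk D) cfgs)) D)) (Block [IConst 1 1])"

locale cells =
  fixes D n :: nat and X :: "nat \<Rightarrow> nat \<Rightarrow> real" and cfgs :: "constraint list list"
  assumes D: "D > 0" and n: "n > 0"
    and valid: "\<And>cfg cn. cfg \<in> set cfgs \<Longrightarrow> cn \<in> set cfg \<Longrightarrow> valid D cn"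
begin

text \<open>Behind the original coordinates, and at least 3, so that the copy never meets the
  scratch registers.\<close>

definition "PB = n * D + 3"
definition "T0 = 18 + D"

text \<open>The words form a trie with at most \<open>1 + K n^D n\<close> nodes, where \<open>K = length cfgs\<close>; the output
  starts behind it.\<close>

definition "OB = T0 + 2 + 2 * length cfgs * n ^ (D + 1)"

definition word :: "constraint list \<Rightarrow> (nat \<Rightarrow> nat) \<Rightarrow> bool list" where
  "word cfg q = map (\<lambda>p. \<forall>cn\<in>set cfg. sat (\<lambda>k. X ((q(D := p)) k)) cn) [0..<n]"

definition allw :: "bool list set" where
  "allw = {word cfg q | cfg q. cfg \<in> set cfgs \<and> (\<forall>k<D. q k < n)}"

definition pts :: "(nat \<Rightarrow> real) \<Rightarrow> bool" where
  "pts R \<longleftrightarrow> (\<forall>i<n. \<forall>c<D. R (PB + i * D + c) = X i c)"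

definition vars :: "nat \<Rightarrow> (nat \<Rightarrow> nat) \<Rightarrow> (nat \<Rightarrow> nat) \<Rightarrow> bool" where
  "vars k q I \<longleftrightarrow> (\<forall>j. k \<le> j \<and> j < D \<longrightarrow> I (17 + j) = PB + q j * D)"

definition fixed :: "(nat \<Rightarrow> nat) \<Rightarrow> bool" where
  "fixed I \<longleftrightarrow> I 0 = n \<and> I 2 = OB \<and> I 7 = PB \<and> I 8 = PB + n * D"

definition store :: "bool list list \<Rightarrow> (nat \<Rightarrow> nat) \<Rightarrow> bool" where
  "store ws I \<longleftrightarrow> I 1 = length ws \<and> I 16 = OB + length ws * n
     \<and> (\<forall>k<length ws. \<forall>i<n. I (OB + k * n + i) = of_bool (ws ! k ! i))"

definition represents :: "bool list set \<Rightarrow> mem \<Rightarrow> bool" where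
  "represents F m \<longleftrightarrow> fixed (fst m) \<and> pts (snd m) \<and> (\<exists>ws \<nu>. distinct ws \<and> set ws = F \<and>
     trie T0 OB (pref F) \<nu> (fst m) \<and> fst m 9 = T0 + 2 * card (pref F) \<and> store ws (fst m))"

lemma length_word [simp]: "length (word cfg q) = n"
  by (simp add: word_def)

lemma word_nth: "p < n \<Longrightarrow> word cfg q ! p = (\<forall>cn\<in>set cfg. sat (\<lambda>k. X ((q(D := p)) k)) cn)"
  by (simp add: word_def del: fun_upd_apply)

lemma sat_cong: "valid D cn \<Longrightarrow> (\<And>k c. k \<le> D \<Longrightarrow> c < D \<Longrightarrow> x k c = y k c) \<Longrightarrow> sat x cn = sat y cn"
proof -
  assume v: "valid D cn" and xy: "\<And>k c. k \<le> D \<Longrightarrow> c < D \<Longrightarrow> x k c = y k c"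
  obtain c0 ts s where cn: "cn = (c0, ts, s)" by (cases cn)
  have "map (\<lambda>(k, c, a). a * x k c) ts = map (\<lambda>(k, c, a). a * y k c) ts"
    using v xy unfolding cn valid_def by (intro map_cong) auto
  then show ?thesis unfolding cn sat.simps by (simp only:)
qed

lemma word_cong: "cfg \<in> set cfgs \<Longrightarrow> (\<And>k. k < D \<Longrightarrow> q k = r k) \<Longrightarrow> word cfg q = word cfg r"
  unfolding word_def using valid by (intro map_cong ball_cong sat_cong) auto

lemma allw: "finite allw" "card allw \<le> length cfgs * n ^ D"
proof -
  let ?f = "\<lambda>(cfg, q). word cfg q"
  let ?Q = "PiE {..<D} (\<lambda>_. {..<n})"
  have sub: "allw \<subseteq> ?f ` (set cfgs \<times> ?Q)"
  proof
    fix w assume "w \<in> allw"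
    then obtain cfg q where w: "w = word cfg q" "cfg \<in> set cfgs" "\<forall>k<D. q k < n"
      unfolding allw_def by blast
    have "word cfg q = word cfg (restrict q {..<D})"
      using w(2) by (rule word_cong) auto
    then have "w = ?f (cfg, restrict q {..<D})" using w by simp
    moreover have "(cfg, restrict q {..<D}) \<in> set cfgs \<times> ?Q" using w by auto
    ultimately show "w \<in> ?f ` (set cfgs \<times> ?Q)" by blast
  qed
  have fin: "finite (set cfgs \<times> ?Q)" by (intro finite_cartesian_product finite_PiE) auto
  then show "finite allw" using sub finite_surj by blast
  have "card allw \<le> card (?f ` (set cfgs \<times> ?Q))"
    using fin sub by (intro card_mono) auto
  also have "\<dots> \<le> card (set cfgs \<times> ?Q)" using fin by (rule card_image_le)
  also have "\<dots> = card (set cfgs) * n ^ D" by (simp add: card_cartesian_product card_PiE)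
  also have "\<dots> \<le> length cfgs * n ^ D" by (simp add: card_length)
  finally show "card allw \<le> length cfgs * n ^ D" .
qed

lemma length_allw: "w \<in> allw \<Longrightarrow> length w = n"
  unfolding allw_def by auto

text \<open>Every trie that occurs has its nodes among the prefixes of \<open>allw\<close>; hence it
  never grows into the output area.\<close>

lemma space: "finite (pref allw)" "S \<subseteq> pref allw \<Longrightarrow> T0 + 2 * card S \<le> OB"
proof -
  show f: "finite (pref allw)" using allw(1) length_allw by (rule finite_pref)
  assume "S \<subseteq> pref allw"
  then have "card S \<le> card (pref allw)" using f by (rule card_mono[rotated])
  also have "\<dots> \<le> 1 + card allw * n" using allw(1) length_allw by (rule card_pref)
  also have "\<dots> \<le> 1 + length cfgs * n ^ D * n" using allw(2) by simp
  finally show "T0 + 2 * card S \<le> OB" unfolding OB_def by (simp add: algebra_simps)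
qed

section \<open>Evaluating one bit of a word\<close>

lemma terms_code:
  assumes "pts R" "\<And>k. k \<le> D \<Longrightarrow> q k < n \<and> I (17 + k) = PB + q k * D"
    and "\<And>k c a. (k, c, a) \<in> set ts \<Longrightarrow> k \<le> D \<and> c < D"
  shows "\<exists>I' R'. fold eff (concat (map term_code ts)) (I, R) = (I', R') \<and> (\<forall>a. a \<noteq> 14 \<longrightarrow> I' a = I a)
     \<and> (\<forall>a\<ge>3. R' a = R a) \<and> R' 0 = R 0 + (\<Sum>(k, c, a)\<leftarrow>ts. a * X (q k) c)"
  using assms
proof (induction ts arbitrary: I R)
  case Nil
  then show ?case by simp
next
  case (Cons t ts)
  obtain k c a where t: "t = (k, c, a)" by (cases t)
  have kc: "k \<le> D" "c < D" using Cons.prems(3)[of k c a] t by auto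
  let ?I = "I(14 := PB + q k * D + c)"
  let ?R = "R(1 := X (q k) c * a, 2 := a, 0 := R 0 + X (q k) c * a)"
  have "R (PB + q k * D + c) = X (q k) c"
    using Cons.prems(1,2) kc unfolding pts_def by blast
  then have 1: "fold eff (term_code t) (I, R) = (?I, ?R)"
    using Cons.prems(2)[OF kc(1)] by (simp add: t term_code_def add_ac fun_upd_twist)
  have "pts ?R" using Cons.prems(1) unfolding pts_def PB_def by simp
  moreover have "q j < n \<and> ?I (17 + j) = PB + q j * D" if "j \<le> D" for j
    using Cons.prems(2)[OF that] by simp
  moreover have "j \<le> D \<and> e < D" if "(j, e, b) \<in> set ts" for j e b
    using Cons.prems(3)[of j e b] that by simp
  ultimately obtain I' R' where "fold eff (concat (map term_code ts)) (?I, ?R) = (I', R')"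
    "\<forall>a. a \<noteq> 14 \<longrightarrow> I' a = ?I a" "\<forall>a\<ge>3. R' a = ?R a" "R' 0 = ?R 0 + (\<Sum>(k, c, a)\<leftarrow>ts. a * X (q k) c)"
    using Cons.IH[of ?R ?I] by blast
  then show ?case by (intro exI[of _ I'] exI[of _ R']) (simp add: t 1[unfolded t] mult.commute del: fun_upd_apply, simp)
qed

lemma straight_terms: "\<forall>i\<in>set (concat (map term_code ts)). straight i"
  by (auto simp: term_code_def)

lemma length_terms: "length (concat (map term_code ts)) = 6 * length ts"
  by (induction ts) (auto simp: term_code_def)

lemma con_wp:
  assumes "pts R" "\<And>k. k \<le> D \<Longrightarrow> q k < n \<and> I (17 + k) = PB + q k * D" "valid D cn"
  shows "wp (con_code cn) (I, R) (con_time cn) (\<lambda>(I', R'). (\<forall>a. a \<noteq> 13 \<and> a \<noteq> 14 \<longrightarrow> I' a = I a)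
     \<and> I' 13 = (if sat (\<lambda>k. X (q k)) cn then I 13 else 0) \<and> (\<forall>a\<ge>3. R' a = R a))"
proof -
  obtain c0 ts s where cn: "cn = (c0, ts, s)" by (cases cn)
  \<comment> \<open>The points start at \<open>PB\<close>, beyond the scratch registers.\<close>
  have "pts (R(0 := c0))" using assms(1) unfolding pts_def PB_def by simp
  from terms_code[of _ q I ts, OF this assms(2)] assms(3)
  obtain I' R' where f: "fold eff (concat (map term_code ts)) (I, R(0 := c0)) = (I', R')"
    and I': "\<And>a. a \<noteq> 14 \<Longrightarrow> I' a = I a" and R': "\<And>a. a \<ge> 3 \<Longrightarrow> R' a = R a"
    "R' 0 = c0 + (\<Sum>(k, c, a)\<leftarrow>ts. a * X (q k) c)"
    unfolding cn valid_def by fastforce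
  have *: "fold eff (RConst 0 c0 # concat (map term_code ts) @ [RConst 1 0]) (I, R) = (I', R'(1 := 0))"
    by (simp add: f)
  have "wp (con_code cn) (I, R) (length (RConst 0 c0 # concat (map term_code ts) @ [RConst 1 0]) + (1 + 2))
     (\<lambda>(I', R'). (\<forall>a. a \<noteq> 13 \<and> a \<noteq> 14 \<longrightarrow> I' a = I a)
     \<and> I' 13 = (if sat (\<lambda>k. X (q k)) cn then I 13 else 0) \<and> (\<forall>a\<ge>3. R' a = R a))"
    unfolding cn con_code.simps
    apply (rule wp_seq, rule wp_block)
    subgoal using straight_terms by auto
    apply (subst *)
    apply (cases s; simp only: if_True if_False; rule wp_cond)
    subgoal by (rule wp_blockI) (auto simp: I' R')
    subgoal by (rule wp_blockI) (auto simp: I' R')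
    subgoal by (rule wp_blockI) (auto simp: I' R')
    subgoal by (rule wp_blockI) (auto simp: I' R')
    done
  then show ?thesis by (rule wp_mono) (simp_all add: cn length_terms)
qed

lemma cons_wp:
  assumes "pts R" "\<And>k. k \<le> D \<Longrightarrow> q k < n \<and> I (17 + k) = PB + q k * D" "\<And>cn. cn \<in> set cfg \<Longrightarrow> valid D cn"
  shows "wp (seqs (map con_code cfg)) (I, R) (sum_list (map con_time cfg))
     (\<lambda>(I', R'). (\<forall>a. a \<noteq> 13 \<and> a \<noteq> 14 \<longrightarrow> I' a = I a)
     \<and> I' 13 = (if \<forall>cn\<in>set cfg. sat (\<lambda>k. X (q k)) cn then I 13 else 0) \<and> (\<forall>a\<ge>3. R' a = R a))"
  using assms
proof (induction cfg arbitrary: I R)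
  case Nil
  show ?case by (auto intro!: wp_blockI)
next
  case (Cons cn cfg)
  have "wp (con_code cn) (I, R) (con_time cn) (\<lambda>(I', R'). (\<forall>a. a \<noteq> 13 \<and> a \<noteq> 14 \<longrightarrow> I' a = I a)
     \<and> I' 13 = (if sat (\<lambda>k. X (q k)) cn then I 13 else 0) \<and> (\<forall>a\<ge>3. R' a = R a))"
    using Cons.prems by (intro con_wp) auto
  then show ?case unfolding list.map seqs.simps sum_list.Cons
  proof (intro wp_seq, elim wp_mono[OF _ order_refl], clarify)
    fix I' R'
    assume *: "\<forall>a. a \<noteq> 13 \<and> a \<noteq> 14 \<longrightarrow> I' a = I a"
      "I' 13 = (if sat (\<lambda>k. X (q k)) cn then I 13 else 0)" "\<forall>a\<ge>3. R' a = (R a :: real)"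
    have "pts R'" using Cons.prems(1) * unfolding pts_def PB_def by simp
    then show "wp (seqs (map con_code cfg)) (I', R') (sum_list (map con_time cfg))
       (\<lambda>(I', R'). (\<forall>a. a \<noteq> 13 \<and> a \<noteq> 14 \<longrightarrow> I' a = I a)
       \<and> I' 13 = (if \<forall>cn\<in>set (cn # cfg). sat (\<lambda>k. X (q k)) cn then I 13 else 0) \<and> (\<forall>a\<ge>3. R' a = R a))"
      using Cons.prems *
      by (intro wp_mono[OF Cons.IH]) (auto simp del: sat.simps split: if_splits)
  qed
qed

lemma bits_wp:
  assumes "pts R" "\<And>k. k \<le> D \<Longrightarrow> q k < n \<and> I (17 + k) = PB + q k * D" "\<And>cn. cn \<in> set cfg \<Longrightarrow> valid D cn"
  shows "wp (bits cfg) (I, R) (bits_time cfg)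
     (\<lambda>(I', R'). (\<forall>a. a \<noteq> 13 \<and> a \<noteq> 14 \<longrightarrow> I' a = I a)
     \<and> I' 13 = of_bool (\<forall>cn\<in>set cfg. sat (\<lambda>k. X (q k)) cn) \<and> (\<forall>a\<ge>3. R' a = R a))"
proof -
  have "wp (bits cfg) (I, R) (length [IConst 13 1] + sum_list (map con_time cfg))
     (\<lambda>(I', R'). (\<forall>a. a \<noteq> 13 \<and> a \<noteq> 14 \<longrightarrow> I' a = I a)
     \<and> I' 13 = of_bool (\<forall>cn\<in>set cfg. sat (\<lambda>k. X (q k)) cn) \<and> (\<forall>a\<ge>3. R' a = R a))"
    unfolding bits_def
  proof (rule wp_seq, rule wp_block)
    have "wp (seqs (map con_code cfg)) (I(13 := 1), R) (sum_list (map con_time cfg))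
     (\<lambda>(I', R'). (\<forall>a. a \<noteq> 13 \<and> a \<noteq> 14 \<longrightarrow> I' a = (I(13 := 1)) a)
     \<and> I' 13 = (if \<forall>cn\<in>set cfg. sat (\<lambda>k. X (q k)) cn then (I(13 := 1)) 13 else 0) \<and> (\<forall>a\<ge>3. R' a = R a))"
      using assms by (intro cons_wp) auto
    then show "wp (seqs (map con_code cfg)) (fold eff [IConst 13 1] (I, R)) (sum_list (map con_time cfg))
     (\<lambda>(I', R'). (\<forall>a. a \<noteq> 13 \<and> a \<noteq> 14 \<longrightarrow> I' a = I a)
     \<and> I' 13 = of_bool (\<forall>cn\<in>set cfg. sat (\<lambda>k. X (q k)) cn) \<and> (\<forall>a\<ge>3. R' a = R a))"
      by (simp add: of_bool_def cong: if_cong)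
  qed simp
  then show ?thesis by (simp add: bits_time_def)
qed

section \<open>Writing one word and inserting it into the trie\<close>

definition walk_inv :: "(nat \<Rightarrow> nat) \<Rightarrow> bool list \<Rightarrow> bool list set \<Rightarrow> bool list list \<Rightarrow> nat \<Rightarrow> mem \<Rightarrow> bool" where
  "walk_inv q w F ws p = (\<lambda>(I, R). fixed I \<and> pts R \<and> vars 0 q I \<and> I (17 + D) = PB + p * D
     \<and> (\<exists>\<nu>. trie T0 OB (pref F \<union> {take i w | i. i \<le> p}) \<nu> I
          \<and> I 9 = T0 + 2 * card (pref F \<union> {take i w | i. i \<le> p}) \<and> I 10 = \<nu> (take p w))
     \<and> I 11 = of_bool (take p w \<notin> pref F) \<and> I 12 = OB + length ws * n + p
     \<and> store ws I \<and> (\<forall>i<p. I (OB + length ws * n + i) = of_bool (w ! i)))"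

text \<open>The flag is stated relative to the old nodes \<open>pref F\<close>: the current trie
  already contains the prefixes of \<open>w\<close> read so far and could not tell whether
  \<open>w\<close> is new.\<close>

lemma walk_step_wp:
  assumes m: "walk_inv q w F ws p m" and p: "p < n" and w: "w = word cfg q" and cfg: "cfg \<in> set cfgs"
    and q: "\<And>k. k < D \<Longrightarrow> q k < n" and F: "pref (insert w F) \<subseteq> pref allw"
  shows "wp (walk_step D cfg) m (bits_time cfg + (6 + ((4 + 2) + 3))) (walk_inv q w F ws (Suc p))"
proof -
  obtain I0 R0 where m0: "m = (I0, R0)" by (cases m)
  define u where "u = take p w"
  define \<beta> where "\<beta> = w ! p"
  define S where "S = pref F \<union> {take i w | i. i \<le> p}"
  define S' where "S' = insert (u @ [\<beta>]) S"
  define O' where "O' = OB + length ws * n + p"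
  have lw: "length w = n" by (simp add: w)
  have tk: "take (Suc p) w = u @ [\<beta>]"
    using p lw by (simp add: u_def \<beta>_def take_Suc_conv_app_nth)
  have S'_eq: "pref F \<union> {take i w | i. i \<le> Suc p} = S'"
    unfolding S'_def S_def tk[symmetric] by (auto simp: le_Suc_eq)
  have S': "S' \<subseteq> pref allw" "u \<in> S"
    using F unfolding pref_insert S'_eq[symmetric] S_def u_def by auto
  have sat_q: "(\<forall>cn\<in>set cfg. sat (\<lambda>k. X ((q(D := p)) k)) cn) = \<beta>"
    using p by (simp add: \<beta>_def w word_nth del: fun_upd_apply)
  obtain \<nu> where I0: "fixed I0" "pts R0" "vars 0 q I0" "I0 (17 + D) = PB + p * D"
    "trie T0 OB S \<nu> I0" "I0 9 = T0 + 2 * card S" "I0 10 = \<nu> u"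
    "I0 11 = of_bool (u \<notin> pref F)" "I0 12 = O'" "store ws I0"
    "\<And>i. i < p \<Longrightarrow> I0 (OB + length ws * n + i) = of_bool (w ! i)"
    using m unfolding walk_inv_def m0 S_def u_def O'_def by auto
  define a where "a = \<nu> u + of_bool \<beta>"
  have OB: "T0 + 2 * card S' \<le> OB" "T0 + 2 * card S \<le> OB"
    using space(2)[of S'] space(2)[of S] S' unfolding S'_def by auto
  have a: "T0 \<le> a" "a < OB"
    using trie_node_bounds(1)[OF I0(5) S'(2)] trie_node_bounds(2)[OF I0(5) S'(2), of \<beta>] OB
    unfolding a_def by auto
  have O': "OB \<le> O'" by (simp add: O'_def)
  have T0: "T0 = 18 + D" by (rule T0_def)
  have [simp]: "a = j \<longleftrightarrow> False" "j = a \<longleftrightarrow> False" "O' = j \<longleftrightarrow> False" "j = O' \<longleftrightarrow> False" if "j < 18 + D" for j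
    using a O' T0 that by auto
  have [simp]: "a \<noteq> O'" "O' \<noteq> a" using a O' by auto
  let ?b2 = "[IStore 12 13, IConst 14 1, IAdd 12 12 14, IAdd 10 10 13, ILoad 15 10, IConst 14 0]"
  let ?c3 = "Cond (ILess 14 15) (Block []) (Block [IStore 10 9, IConst 14 2, IAdd 9 9 14, IConst 11 1])"
  let ?b4 = "[ILoad 10 10, IConst 14 D, IAdd (17 + D) (17 + D) 14]"
  have "wp (bits cfg) (I0, R0) (bits_time cfg)
     (\<lambda>(I', R'). (\<forall>a. a \<noteq> 13 \<and> a \<noteq> 14 \<longrightarrow> I' a = I0 a)
     \<and> I' 13 = of_bool (\<forall>cn\<in>set cfg. sat (\<lambda>k. X ((q(D := p)) k)) cn) \<and> (\<forall>a\<ge>3. R' a = R0 a))"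
    using I0(2,3,4) p q valid[OF cfg] unfolding vars_def by (intro bits_wp) auto
  then show ?thesis unfolding walk_step_def m0 sat_q
  proof (intro wp_seq, elim wp_mono[OF _ order_refl], clarify)
    fix I R
    assume I: "\<forall>a. a \<noteq> 13 \<and> a \<noteq> 14 \<longrightarrow> I a = I0 a" "I 13 = of_bool \<beta>" "\<forall>a\<ge>3. R a = (R0 a :: real)"
    have "pts R" using I0(2) I(3) unfolding pts_def PB_def by simp
    define I1 where "I1 = fst (fold eff ?b2 (I, R))"
    have f1: "fold eff ?b2 (I, R) = (I1, R)" by (simp add: I1_def)
    have I1: "I1 10 = a" "I1 12 = Suc O'" "I1 14 = 0" "I1 O' = of_bool \<beta>" "I1 15 = I0 a"
      using I I0(7,9) unfolding I1_def by (simp_all add: a_def[symmetric])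
    have I1x: "I1 x = I0 x" if "x \<notin> {10, 12, 13, 14, 15, O'}" for x
      using I I0(7,9) that unfolding I1_def by simp
    have a_val: "I0 a = (if u @ [\<beta>] \<in> S then \<nu> (u @ [\<beta>]) else 0)"
      using I0(5) S'(2) unfolding trie_def a_def by auto
    let ?Q = "\<lambda>(I2, R2). R2 = R \<and> (\<exists>\<mu>. trie T0 OB S' \<mu> I2 \<and> I2 9 = T0 + 2 * card S' \<and> I2 a = \<mu> (u @ [\<beta>]))
        \<and> I2 11 = of_bool (u @ [\<beta>] \<notin> pref F) \<and> I2 10 = a
        \<and> (\<forall>x. x \<notin> {a, 9, 11, 14} \<longrightarrow> I2 x = I1 x)"
    have "wp ?c3 (I1, R) (4 + 2) ?Q"
    proof (rule wp_cond)
      assume "holds (ILess 14 15) (I1, R)"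
      then have uS: "u @ [\<beta>] \<in> S" using I1 a_val by (auto split: if_splits)
      then have S: "S' = S" unfolding S'_def by auto
      \<comment> \<open>The nodes that \<open>w\<close> itself has added so far have length at most
        \<open>p\<close>, so a node of length \<open>Suc p\<close> is an old one.\<close>
      have "u @ [\<beta>] \<in> pref F"
      proof -
        have "length (u @ [\<beta>]) = Suc p" using p lw by (simp add: u_def)
        moreover have "length (take i w) < Suc p" if "i \<le> p" for i using that by simp
        ultimately show ?thesis using uS unfolding S_def by fastforce
      qed
      moreover from this have "u \<in> pref F"
        by (rule pref_closed)
      moreover have "trie T0 OB S \<nu> I1"
        by (rule trie_cong[OF I0(5) _ OB(2)]) (use O' T0 in \<open>auto intro!: I1x\<close>)
      ultimately show "wp (Block []) (I1, R) 4 ?Q"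
        using I0(6,8) I1 a_val uS by (intro wp_blockI) (auto simp: S I1x intro!: exI[of _ \<nu>])
    next
      assume "\<not> holds (ILess 14 15) (I1, R)"
      then have "\<not> 0 < I0 a" using I1 by simp
      \<comment> \<open>Node addresses are at least \<open>T0 > 0\<close>, so 0 is free to mean a
        missing child.\<close>
      moreover have "\<nu> (u @ [\<beta>]) > 0" if "u @ [\<beta>] \<in> S"
        using trie_node_bounds(1)[OF I0(5) that] T0 by simp
      ultimately have uS: "u @ [\<beta>] \<notin> S" using a_val by auto
      have "finite S" using I0(5) unfolding trie_def by blast
      then have cS: "card S' = Suc (card S)" using uS unfolding S'_def by simp
      let ?b3 = "[IStore 10 9, IConst 14 2, IAdd 9 9 14, IConst 11 1]"
      define I2 where "I2 = fst (fold eff ?b3 (I1, R))"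
      have f2: "fold eff ?b3 (I1, R) = (I2, R)" by (simp add: I2_def)
      have I2: "I2 10 = a" "I2 11 = 1" "I2 9 = T0 + 2 * card S'" "I2 a = T0 + 2 * card S"
        using I1 I0(6) I1x[of 9] unfolding I2_def by (simp_all add: cS)
      have I2x: "I2 x = I1 x" if "x \<notin> {a, 9, 11, 14}" for x
        using I1 that unfolding I2_def by simp
      have "trie T0 OB S' (\<nu>(u @ [\<beta>] := T0 + 2 * card S)) I2"
        unfolding S'_def
      proof (rule trie_insert[OF I0(5) S'(2) uS])
        show "T0 + 2 * card S + 2 \<le> OB" using OB cS by simp
        show "I2 x = (I0(\<nu> u + of_bool \<beta> := T0 + 2 * card S)) x" if "T0 \<le> x" "x < OB" for x
        proof (cases "x = a")
          case True
          then show ?thesis using I2 by (simp add: a_def)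
        next
          case False
          then show ?thesis using that T0 O' I2x[of x] I1x[of x] by (auto simp: a_def[symmetric])
        qed
      qed
      moreover have "u @ [\<beta>] \<notin> pref F" using uS unfolding S_def by auto
      ultimately show "wp (Block ?b3) (I1, R) 4 ?Q"
        using I2 by (intro wp_blockI, simp, simp, unfold f2) (auto simp: I2x intro!: exI[of _ "\<nu>(u @ [\<beta>] := T0 + 2 * card S)"])
    qed
    then show "wp (Seq (Block ?b2) (Seq ?c3 (Block ?b4))) (I, R) (6 + ((4 + 2) + 3)) (walk_inv q w F ws (Suc p))"
    proof (intro wp_seq wp_blockI, simp, simp, unfold f1, elim wp_mono[OF _ order_refl])
      fix m2 assume "?Q m2"
      then obtain I2 \<mu> where m2: "m2 = (I2, R)" and I2: "trie T0 OB S' \<mu> I2" "I2 9 = T0 + 2 * card S'" "I2 a = \<mu> (u @ [\<beta>])"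
        "I2 11 = of_bool (u @ [\<beta>] \<notin> pref F)" "I2 10 = a" "\<forall>x. x \<notin> {a, 9, 11, 14} \<longrightarrow> I2 x = I1 x"
        by (cases m2) blast
      define I3 where "I3 = fst (fold eff ?b4 (I2, R))"
      have f3: "fold eff ?b4 (I2, R) = (I3, R)" by (simp add: I3_def)
      have I3: "I3 10 = \<mu> (u @ [\<beta>])" "I3 (17 + D) = PB + Suc p * D"
        using I2 I1x[of "17 + D"] I0(4) unfolding I3_def by simp_all
      have I3x: "I3 x = I2 x" if "x \<notin> {10, 14, 17 + D}" for x
        using that unfolding I3_def by simp
      have out: "I3 x = I1 x" if "x \<ge> OB" for x
        using that a T0 I2(6) I3x[of x] by simp
      have out0: "I3 x = I0 x" if "x \<ge> OB" "x \<noteq> O'" for x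
        using that out[OF that(1)] I1x[of x] T0 OB by auto
      have low: "I3 x = I0 x" if "x \<notin> {9, 10, 11, 12, 13, 14, 15}" "x < 17 + D" for x
        using that I3x[of x] I2(6) I1x[of x] by auto
      have "trie T0 OB S' \<mu> I3"
        by (rule trie_cong[OF I2(1) _ OB(1)]) (use T0 in \<open>auto intro!: I3x\<close>)
      moreover have "fixed I3" using I0(1) low unfolding fixed_def by simp
      moreover have "vars 0 q I3" using I0(3) low unfolding vars_def by simp
      moreover have "store ws I3"
      proof -
        have "OB + k * n + i \<noteq> O'" if "k < length ws" "i < n" for k i
        proof -
          have "Suc k * n \<le> length ws * n" using that by (intro mult_right_mono) auto
          then show ?thesis using that unfolding O'_def by simp
        qed
        then show ?thesis using I0(10) low[of 1] low[of 16] out0 D unfolding store_def by simp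
      qed
      moreover have "I3 12 = OB + length ws * n + Suc p"
        using I3x[of 12] I2(6) I1 by (simp add: O'_def)
      moreover have "I3 (OB + length ws * n + i) = of_bool (w ! i)" if "i < Suc p" for i
        using that out[of O'] out0[of "OB + length ws * n + i"] I0(11)[of i] I1(4) O'
        by (cases "i = p") (auto simp: O'_def \<beta>_def)
      ultimately show "wp (Block ?b4) m2 3 (walk_inv q w F ws (Suc p))"
        unfolding m2 using \<open>pts R\<close> I3 I2(2,4) I3x[of 9] I3x[of 11]
        by (intro wp_blockI, simp, simp, unfold f3 walk_inv_def S'_eq tk) auto
    qed
  qed
qed


lemma pref_take_0: "pref F \<union> {take i w | i. i \<le> (0::nat)} = pref F"
  by (auto simp: pref_def)

lemma pref_take_all: "length w = m \<Longrightarrow> pref F \<union> {take i w | i. i \<le> m} = pref (insert w F)"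
proof -
  assume w: "length w = m"
  have "{take i w | i. i \<le> m} = {take i w | i. True}"
  proof (intro subset_antisym subsetI)
    fix v assume "v \<in> {take i w | i. True}"
    then obtain i where "v = take i w" by blast
    then have "v = take (min i m) w" using w by (simp add: min_def)
    then show "v \<in> {take i w | i. i \<le> m}" by auto
  qed auto
  then show ?thesis unfolding pref_insert by simp
qed

lemma representsI:
  "fixed I \<Longrightarrow> pts R \<Longrightarrow> distinct ws \<Longrightarrow> set ws = F \<Longrightarrow> trie T0 OB (pref F) \<nu> I
    \<Longrightarrow> I 9 = T0 + 2 * card (pref F) \<Longrightarrow> store ws I \<Longrightarrow> represents F (I, R)"
  unfolding represents_def by auto

lemma loop_iff: "PB + v * D < PB + n * D \<longleftrightarrow> v < n"
  using D by simp

lemma walk_wp: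
  assumes m: "represents F m" "vars 0 q (fst m)" and cfg: "cfg \<in> set cfgs"
    and q: "\<And>k. k < D \<Longrightarrow> q k < n" and F: "insert (word cfg q) F \<subseteq> allw"
  shows "wp (walk D cfg) m (5 + ((n * ((bits_time cfg + (6 + ((4 + 2) + 3))) + 2) + 2) + (1 + (3 + 2))))
     (\<lambda>m'. represents (insert (word cfg q) F) m' \<and> vars 0 q (fst m'))"
proof -
  obtain I0 R0 where m0: "m = (I0, R0)" by (cases m)
  define w where "w = word cfg q"
  have lw: "length w = n" by (simp add: w_def)
  have lF: "length v = n" if "v \<in> F" for v using F that length_allw by blast
  have pF: "pref (insert w F) \<subseteq> pref allw" using F by (intro pref_mono) (simp add: w_def)
  have OB: "T0 + 2 * card (pref (insert w F)) \<le> OB" "T0 + 2 * card (pref F) \<le> OB"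
    using space(2)[OF pF] space(2)[OF pref_mono[of F allw]] F by auto
  have T0: "T0 = 18 + D" by (rule T0_def)
  obtain ws \<nu> where I0: "fixed I0" "pts R0" "distinct ws" "set ws = F" "trie T0 OB (pref F) \<nu> I0"
    "I0 9 = T0 + 2 * card (pref F)" "store ws I0"
    using m(1) unfolding represents_def m0 by auto
  let ?b1 = "[IConst 10 (18 + D), IConst 11 0, IConst 14 0, IAdd 12 16 14, IAdd (17 + D) 7 14]"
  define I1 where "I1 = fst (fold eff ?b1 (I0, R0))"
  have f1: "fold eff ?b1 (I0, R0) = (I1, R0)" by (simp add: I1_def)
  have I1: "I1 10 = T0" "I1 11 = 0" "I1 12 = OB + length ws * n" "I1 (17 + D) = PB"
    using I0(1,7) unfolding I1_def fixed_def store_def T0 by simp_all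
  have I1x: "I1 x = I0 x" if "x \<notin> {10, 11, 12, 14, 17 + D}" for x
    using that unfolding I1_def by simp
  have start: "walk_inv q w F ws 0 (I1, R0)"
  proof -
    have nil: "[] \<in> pref F" "\<nu> [] = T0" using I0(5) unfolding trie_def by auto
    have "trie T0 OB (pref F) \<nu> I1"
      by (rule trie_cong[OF I0(5) _ OB(2)]) (auto simp: T0 intro!: I1x)
    moreover have "store ws I1"
      using I0(7) OB unfolding store_def T0 by (auto simp: I1x)
    moreover have "fixed I1" "vars 0 q I1" "I1 9 = I0 9"
      using I0(1) m(2) unfolding fixed_def vars_def m0 by (auto simp: I1x)
    ultimately show ?thesis
      unfolding walk_inv_def pref_take_0 using I0(2,6) I1 nil by auto
  qed
  have loop: "wp (While (ILess (17 + D) 8) (walk_step D cfg)) (I1, R0)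
     (n * ((bits_time cfg + (6 + ((4 + 2) + 3))) + 2) + 2) (walk_inv q w F ws n)"
  proof (rule wp_loop[where Inv = "walk_inv q w F ws"])
    show "walk_inv q w F ws 0 (I1, R0)" by (rule start)
  next
    fix k m assume k: "k < n" "walk_inv q w F ws k m"
    then have "holds (ILess (17 + D) 8) m"
      using loop_iff[of k] unfolding walk_inv_def fixed_def by (cases m) simp
    moreover have "wp (walk_step D cfg) m (bits_time cfg + (6 + ((4 + 2) + 3))) (walk_inv q w F ws (Suc k))"
      by (rule walk_step_wp[OF k(2,1) w_def cfg q pF])
    ultimately show "holds (ILess (17 + D) 8) m \<and>
      wp (walk_step D cfg) m (bits_time cfg + (6 + ((4 + 2) + 3))) (walk_inv q w F ws (Suc k))" by blast
  next
    fix m assume "walk_inv q w F ws n m"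
    then show "\<not> holds (ILess (17 + D) 8) m"
      unfolding walk_inv_def fixed_def by (cases m) simp
  qed
  have fin: "wp (Seq (Block [IConst 14 0])
     (Cond (ILess 14 11) (Block [IConst 14 1, IAdd 1 1 14, IAdd 16 16 0]) (Block []))) m (1 + (3 + 2))
     (\<lambda>m'. represents (insert w F) m' \<and> vars 0 q (fst m'))" if "walk_inv q w F ws n m" for m
  proof -
    obtain I R where m: "m = (I, R)" by (cases m)
    \<comment> \<open>This turns the flag, a statement about prefixes, into the statement that the
      complete word is new.\<close>
    have "w \<in> pref F \<longleftrightarrow> w \<in> F" using lF lw n by (rule mem_pref_iff)
    with that[unfolded m walk_inv_def pref_take_all[OF lw]] lw
    obtain \<nu> where I: "fixed I" "pts R" "vars 0 q I" "trie T0 OB (pref (insert w F)) \<nu> I"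
      "I 9 = T0 + 2 * card (pref (insert w F))" "I 11 = of_bool (w \<notin> F)" "store ws I"
      "\<And>i. i < n \<Longrightarrow> I (OB + length ws * n + i) = of_bool (w ! i)"
      by auto
    show ?thesis unfolding m
    proof (intro wp_seq wp_blockI, simp, simp, intro wp_cond)
      assume "holds (ILess 14 11) (fold eff [IConst 14 0] (I, R))"
      then have wF: "w \<notin> F" using I(6) by (simp split: if_splits)
      define I' where "I' = fst (fold eff [IConst 14 1, IAdd 1 1 14, IAdd 16 16 0] (I(14 := 0), R))"
      have f: "fold eff [IConst 14 1, IAdd 1 1 14, IAdd 16 16 0] (I(14 := 0), R) = (I', R)"
        by (simp add: I'_def)
      have I'x: "I' x = I x" if "x \<notin> {1, 14, 16}" for x using that unfolding I'_def by simp
      have "trie T0 OB (pref (insert w F)) \<nu> I'"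
        by (rule trie_cong[OF I(4) _ OB(1)]) (auto simp: T0 intro!: I'x)
      moreover have "store (ws @ [w]) I'"
      proof -
        have "I' 1 = Suc (length ws)" "I' 16 = OB + Suc (length ws) * n"
          using I(1,7) unfolding I'_def fixed_def store_def by simp_all
        then show ?thesis
          using I(7,8) OB unfolding store_def T0 by (auto simp: I'x nth_append less_Suc_eq)
      qed
      moreover have "fixed I'" "vars 0 q I'" "I' 9 = I 9"
        using I(1,3) unfolding fixed_def vars_def by (auto simp: I'x)
      moreover have "distinct (ws @ [w])" "set (ws @ [w]) = insert w F" using I0(3,4) wF by auto
      ultimately have "represents (insert w F) (I', R) \<and> vars 0 q I'"
        using I(2,5) by (intro conjI representsI[of I' R "ws @ [w]" _ \<nu>]) simp_all
      then show "wp (Block [IConst 14 1, IAdd 1 1 14, IAdd 16 16 0]) (fold eff [IConst 14 0] (I, R)) 3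
         (\<lambda>m'. represents (insert w F) m' \<and> vars 0 q (fst m'))"
        using f by (intro wp_blockI) simp_all
    next
      assume "\<not> holds (ILess 14 11) (fold eff [IConst 14 0] (I, R))"
      then have wF: "insert w F = F" using I(6) by (auto split: if_splits)
      define I' where "I' = I(14 := 0)"
      have f: "fold eff [IConst 14 0] (I, R) = (I', R)" by (simp add: I'_def)
      have I'x: "I' x = I x" if "x \<noteq> 14" for x using that unfolding I'_def by simp
      have "trie T0 OB (pref (insert w F)) \<nu> I'"
        by (rule trie_cong[OF I(4) _ OB(1)]) (auto simp: T0 intro!: I'x)
      moreover have "store ws I'"
        using I(7) OB unfolding store_def T0 by (auto simp: I'x)
      moreover have "fixed I'" "vars 0 q I'" "I' 9 = I 9"
        using I(1,3) unfolding fixed_def vars_def by (auto simp: I'x)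
      ultimately have "represents (insert w F) (I', R) \<and> vars 0 q I'"
        using I(2,5) I0(3,4) wF by (intro conjI representsI[of I' R ws _ \<nu>]) simp_all
      then show "wp (Block []) (fold eff [IConst 14 0] (I, R)) 3
         (\<lambda>m'. represents (insert w F) m' \<and> vars 0 q (fst m'))"
        unfolding f by (intro wp_blockI) simp_all
    qed
  qed
  show ?thesis unfolding walk_def m0 w_def[symmetric]
  proof (rule wp_seq, rule wp_blockI)
    show "wp (Seq (While (ILess (17 + D) 8) (walk_step D cfg)) (Seq (Block [IConst 14 0])
       (Cond (ILess 14 11) (Block [IConst 14 1, IAdd 1 1 14, IAdd 16 16 0]) (Block [])))) (fold eff ?b1 (I0, R0))
       ((n * ((bits_time cfg + (6 + ((4 + 2) + 3))) + 2) + 2) + (1 + (3 + 2)))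
       (\<lambda>m'. represents (insert w F) m' \<and> vars 0 q (fst m'))"
      unfolding f1 by (intro wp_seq[OF wp_mono[OF loop order_refl]] fin)
  qed simp_all
qed

section \<open>The loops over tuples of points\<close>

definition wordsF :: "nat \<Rightarrow> (nat \<Rightarrow> nat) \<Rightarrow> bool list set" where
  "wordsF k q = {word cfg r | cfg r. cfg \<in> set cfgs \<and> (\<forall>j<k. r j < n) \<and> (\<forall>j\<ge>k. r j = q j)}"

text \<open>Per point, 15 steps of bookkeeping and 2 of loop control give 17; the 13 steps of a walk
  outside its loop are absorbed by replacing \<open>n\<close> with \<open>n + 1\<close>.\<close>

definition "walks_time = (\<Sum>cfg\<leftarrow>cfgs. bits_time cfg + 17)"

lemma walks_wp:
  assumes "represents F m" "vars 0 q (fst m)" "set cl \<subseteq> set cfgs"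
    and q: "\<And>k. k < D \<Longrightarrow> q k < n" and "F \<union> (\<lambda>cfg. word cfg q) ` set cl \<subseteq> allw"
  shows "wp (seqs (map (walk D) cl)) m ((\<Sum>cfg\<leftarrow>cl. bits_time cfg + 17) * (n + 1))
     (\<lambda>m'. represents (F \<union> (\<lambda>cfg. word cfg q) ` set cl) m' \<and> vars 0 q (fst m'))"
  using assms(1-3,5)
proof (induction cl arbitrary: F m)
  case Nil
  then show ?case by (auto intro: wp_blockI)
next
  case (Cons cfg cl)
  have "wp (walk D cfg) m ((bits_time cfg + 17) * (n + 1))
     (\<lambda>m'. represents (insert (word cfg q) F) m' \<and> vars 0 q (fst m'))"
    by (rule wp_mono[OF walk_wp]) (use Cons.prems q in \<open>auto simp: algebra_simps\<close>)
  then have "wp (seqs (map (walk D) (cfg # cl))) m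
     ((bits_time cfg + 17) * (n + 1) + (\<Sum>cfg\<leftarrow>cl. bits_time cfg + 17) * (n + 1))
     (\<lambda>m'. represents (F \<union> (\<lambda>cfg. word cfg q) ` set (cfg # cl)) m' \<and> vars 0 q (fst m'))"
    unfolding list.map seqs.simps
  proof (intro wp_seq, elim wp_mono[OF _ order_refl])
    fix m' assume m': "represents (insert (word cfg q) F) m' \<and> vars 0 q (fst m')"
    have *: "F \<union> (\<lambda>cfg. word cfg q) ` set (cfg # cl) = insert (word cfg q) F \<union> (\<lambda>cfg. word cfg q) ` set cl" by auto
    show "wp (seqs (map (walk D) cl)) m' ((\<Sum>cfg\<leftarrow>cl. bits_time cfg + 17) * (n + 1))
     (\<lambda>m'. represents (F \<union> (\<lambda>cfg. word cfg q) ` set (cfg # cl)) m' \<and> vars 0 q (fst m'))"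
      unfolding * using m' Cons.prems by (intro Cons.IH) auto
  qed
  then show ?case by (simp only: list.map sum_list.Cons add_mult_distrib[symmetric])
qed

lemma wordsF_0: "wordsF 0 q = (\<lambda>cfg. word cfg q) ` set cfgs"
proof -
  have "r = q" if "\<forall>j\<ge>0. r j = q j" for r :: "nat \<Rightarrow> nat" using that by auto
  then show ?thesis unfolding wordsF_def by auto
qed

lemma wordsF_Suc: "wordsF (Suc k) q = (\<Union>v<n. wordsF k (q(k := v)))"
proof (intro subset_antisym subsetI)
  fix x assume "x \<in> wordsF (Suc k) q"
  then obtain cfg r where r: "x = word cfg r" "cfg \<in> set cfgs" "\<forall>j<Suc k. r j < n" "\<forall>j\<ge>Suc k. r j = q j"
    unfolding wordsF_def by blast
  then have "x \<in> wordsF k (q(k := r k))"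
    unfolding wordsF_def by (intro CollectI exI[of _ cfg] exI[of _ r]) auto
  then show "x \<in> (\<Union>v<n. wordsF k (q(k := v)))" using r by blast
next
  fix x assume "x \<in> (\<Union>v<n. wordsF k (q(k := v)))"
  then obtain v cfg r where "v < n" "x = word cfg r" "cfg \<in> set cfgs" "\<forall>j<k. r j < n" "\<forall>j\<ge>k. r j = (q(k := v)) j"
    unfolding wordsF_def by blast
  then show "x \<in> wordsF (Suc k) q"
    unfolding wordsF_def by (intro CollectI exI[of _ cfg] exI[of _ r]) (auto simp: less_Suc_eq)
qed

text \<open>Frame rule for the loop bookkeeping, which touches only register 14 and the loop
  registers, all of them below \<open>T0\<close>.\<close>

lemma represents_cong:
  assumes "represents F (I, R)" "F \<subseteq> allw" "\<And>x. x < 10 \<or> x = 16 \<or> x \<ge> T0 \<Longrightarrow> I' x = I x"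
  shows "represents F (I', R)"
proof -
  have OB: "T0 + 2 * card (pref F) \<le> OB" using assms(2) by (intro space(2) pref_mono)
  obtain ws \<nu> where I: "fixed I" "pts R" "distinct ws" "set ws = F" "trie T0 OB (pref F) \<nu> I"
    "I 9 = T0 + 2 * card (pref F)" "store ws I"
    using assms(1) unfolding represents_def by auto
  have "trie T0 OB (pref F) \<nu> I'"
    by (rule trie_cong[OF I(5) _ OB]) (auto simp: assms(3))
  moreover have "store ws I'" using I(7) OB unfolding store_def by (auto simp: assms(3))
  moreover have "fixed I'" "I' 9 = I 9" using I(1) unfolding fixed_def by (auto simp: assms(3))
  ultimately show ?thesis
    using I by (intro representsI[of I' R ws _ \<nu>]) simp_all
qed

text \<open>The set \<open>F\<close> of words already stored is arbitrary, so that an outer loop can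
  accumulate the words of its earlier passes and apply the induction hypothesis again.\<close>

lemma nest_wp:
  assumes "k \<le> D" "represents F m" "vars k q (fst m)" "\<And>j. k \<le> j \<Longrightarrow> j < D \<Longrightarrow> q j < n" "F \<union> wordsF k q \<subseteq> allw"
  shows "wp (nest D (seqs (map (walk D) cfgs)) k) m ((walks_time + 6 * k) * (n + 1) ^ (k + 1))
     (\<lambda>m'. represents (F \<union> wordsF k q) m' \<and> vars k q (fst m'))"
  using assms
proof (induction k arbitrary: F m q)
  case 0
  then show ?case unfolding wordsF_0 nest.simps walks_time_def
    using walks_wp[of F m q cfgs] by simp
next
  case (Suc k)
  obtain I0 R0 where m0: "m = (I0, R0)" by (cases m)
  let ?t = "(walks_time + 6 * k) * (n + 1) ^ (k + 1)"
  let ?body = "Seq (nest D (seqs (map (walk D) cfgs)) k) (Block [IConst 14 D, IAdd (17 + k) (17 + k) 14])"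
  let ?G = "\<lambda>v. F \<union> (\<Union>u<v. wordsF k (q(k := u)))"
  let ?Inv = "\<lambda>v m'. represents (?G v) m' \<and> vars (Suc k) q (fst m') \<and> fst m' (17 + k) = PB + v * D"
  have G: "?G v \<subseteq> allw" if "v \<le> n" for v
  proof -
    have "(\<Union>u<v. wordsF k (q(k := u))) \<subseteq> (\<Union>u<n. wordsF k (q(k := u)))"
      using that by (intro UN_mono) auto
    then show ?thesis using Suc.prems(5) unfolding wordsF_Suc by blast
  qed
  define I1 where "I1 = fst (fold eff [IConst 14 0, IAdd (17 + k) 7 14] (I0, R0))"
  have f1: "fold eff [IConst 14 0, IAdd (17 + k) 7 14] (I0, R0) = (I1, R0)" by (simp add: I1_def)
  have I1: "I1 (17 + k) = PB" using Suc.prems(2) unfolding I1_def represents_def fixed_def m0 by simp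
  have I1x: "I1 x = I0 x" if "x \<noteq> 14" "x \<noteq> 17 + k" for x using that unfolding I1_def by simp
  have start: "?Inv 0 (I1, R0)"
  proof -
    have "represents F (I1, R0)"
      by (rule represents_cong[OF Suc.prems(2)[unfolded m0]]) (use Suc.prems(1,5) in \<open>auto simp: T0_def intro!: I1x\<close>)
    then show ?thesis using Suc.prems(3) I1 unfolding vars_def m0 by (auto simp: I1x)
  qed
  have "wp (While (ILess (17 + k) 8) ?body) (I1, R0) (n * ((?t + 2) + 2) + 2) (?Inv n)"
  proof (rule wp_loop[where Inv = ?Inv])
    show "?Inv 0 (I1, R0)" by (rule start)
  next
    fix v m assume v: "v < n" and m: "?Inv v m"
    have "holds (ILess (17 + k) 8) m"
    proof -
      have "fixed (fst m)" using m unfolding represents_def by blast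
      then show ?thesis using m loop_iff[of v] v unfolding fixed_def by (cases m) simp
    qed
    moreover have "wp ?body m (?t + 2) (?Inv (Suc v))"
    proof (intro wp_seq)
      have "wp (nest D (seqs (map (walk D) cfgs)) k) m ?t
         (\<lambda>m'. represents (?G v \<union> wordsF k (q(k := v))) m' \<and> vars k (q(k := v)) (fst m'))"
      proof (rule Suc.IH)
        show "vars k (q(k := v)) (fst m)"
          using m unfolding vars_def by (auto simp: le_Suc_eq)
        show "?G v \<union> wordsF k (q(k := v)) \<subseteq> allw"
          using G[of "Suc v"] v by (simp add: lessThan_Suc Un_ac)
      qed (use m v Suc.prems in auto)
      moreover have "?G v \<union> wordsF k (q(k := v)) = ?G (Suc v)" by (auto simp: lessThan_Suc)
      ultimately have "wp (nest D (seqs (map (walk D) cfgs)) k) m ?t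
         (\<lambda>m'. represents (?G (Suc v)) m' \<and> vars k (q(k := v)) (fst m'))" by simp
      then show "wp (nest D (seqs (map (walk D) cfgs)) k) m ?t
         (\<lambda>m. wp (Block [IConst 14 D, IAdd (17 + k) (17 + k) 14]) m 2 (?Inv (Suc v)))"
      proof (elim wp_mono[OF _ order_refl])
        fix m' assume m': "represents (?G (Suc v)) m' \<and> vars k (q(k := v)) (fst m')"
        obtain I R where IR: "m' = (I, R)" by (cases m')
        define I' where "I' = fst (fold eff [IConst 14 D, IAdd (17 + k) (17 + k) 14] (I, R))"
        have f: "fold eff [IConst 14 D, IAdd (17 + k) (17 + k) 14] (I, R) = (I', R)" by (simp add: I'_def)
        have I'x: "I' x = I x" if "x \<noteq> 14" "x \<noteq> 17 + k" for x using that unfolding I'_def by simp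
        have "represents (?G (Suc v)) (I', R)"
          by (rule represents_cong[of _ I])
            (use m' IR Suc.prems(1) G[of "Suc v"] v in \<open>auto simp: T0_def intro!: I'x\<close>)
        moreover have "I' (17 + k) = PB + Suc v * D"
          using m' Suc.prems(1) unfolding I'_def vars_def IR by simp
        moreover have "vars (Suc k) q I'" using m' unfolding vars_def IR by (auto simp: I'x)
        ultimately show "wp (Block [IConst 14 D, IAdd (17 + k) (17 + k) 14]) m' 2 (?Inv (Suc v))"
          unfolding IR by (intro wp_blockI, simp, simp, unfold f) simp
      qed
    qed
    ultimately show "holds (ILess (17 + k) 8) m \<and> wp ?body m (?t + 2) (?Inv (Suc v))" by blast
  next
    fix m assume m: "?Inv n m"
    show "\<not> holds (ILess (17 + k) 8) m"
    proof -
      have "fixed (fst m)" using m unfolding represents_def by blast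
      then show ?thesis using m unfolding fixed_def by (cases m) simp
    qed
  qed
  then have "wp (nest D (seqs (map (walk D) cfgs)) (Suc k)) m (2 + (n * ((?t + 2) + 2) + 2)) (?Inv n)"
    unfolding nest.simps m0 by (intro wp_seq, intro wp_blockI) (simp, simp, unfold f1)
  moreover have "2 + (n * ((?t + 2) + 2) + 2) \<le> (walks_time + 6 * Suc k) * (n + 1) ^ (Suc k + 1)"
  proof -
    \<comment> \<open>A level multiplies the inner cost by at most \<open>n + 1\<close> and adds
      \<open>4 * (n + 1)\<close> for control, which the increment 6 of the coefficient
      covers.\<close>
    have "2 + (n * ((?t + 2) + 2) + 2) \<le> ?t * (n + 1) + 4 * (n + 1)" by (simp add: algebra_simps)
    also have "4 * (n + 1) \<le> 6 * (n + 1) ^ (Suc k + 1)"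
      using power_increasing[of 1 "Suc k + 1" "n + 1"] by simp
    finally show ?thesis by (simp add: algebra_simps)
  qed
  ultimately show ?case unfolding wordsF_Suc by (rule wp_mono) auto
qed

section \<open>Preparing registers and memory\<close>

lemma add_iterate: "(eff (IAdd 8 8 0) ^^ k) (I, R) = (I(8 := I 8 + k * I 0), R)"
  by (induction k arbitrary: I) (auto simp: add_ac)

lemma mul_n_wp:
  assumes "I 0 = n"
  shows "wp mul_n (I, R) (2 + ((n * (3 + 2) + 2) + 2))
     (\<lambda>(I', R'). R' = R \<and> I' 16 = I 16 * n \<and> (\<forall>x. x \<notin> {10, 14, 15, 16} \<longrightarrow> I' x = I x))"
  unfolding mul_n_def
proof (rule wp_seq, rule wp_blockI, simp, simp, rule wp_seq)
  let ?Inv = "\<lambda>k (I', R'). R' = R \<and> I' 16 = I 16 \<and> I' 10 = k \<and> I' 15 = k * I 16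
    \<and> (\<forall>x. x \<notin> {10, 14, 15, 16} \<longrightarrow> I' x = I x)"
  have "wp (While (ILess 10 0) (Block [IAdd 15 15 16, IConst 14 1, IAdd 10 10 14]))
    (fold eff [IConst 15 0, IConst 10 0] (I, R)) (n * (3 + 2) + 2) (?Inv n)"
    by (rule wp_loop[where Inv = ?Inv]) (use assms in \<open>auto intro!: wp_blockI\<close>)
  then show "wp (While (ILess 10 0) (Block [IAdd 15 15 16, IConst 14 1, IAdd 10 10 14]))
    (fold eff [IConst 15 0, IConst 10 0] (I, R)) (n * (3 + 2) + 2)
    (\<lambda>m. wp (Block [IConst 14 0, IAdd 16 15 14]) m 2
       (\<lambda>(I', R'). R' = R \<and> I' 16 = I 16 * n \<and> (\<forall>x. x \<notin> {10, 14, 15, 16} \<longrightarrow> I' x = I x)))"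
    by (rule wp_mono) (auto intro!: wp_blockI)
qed

lemma muls_wp:
  assumes "I 0 = n"
  shows "wp (seqs (replicate k mul_n)) (I, R) (k * (2 + ((n * (3 + 2) + 2) + 2)))
     (\<lambda>(I', R'). R' = R \<and> I' 16 = I 16 * n ^ k \<and> (\<forall>x. x \<notin> {10, 14, 15, 16} \<longrightarrow> I' x = I x))"
  using assms
proof (induction k arbitrary: I)
  case 0
  then show ?case by (auto intro!: wp_blockI)
next
  case (Suc k)
  have "wp mul_n (I, R) (2 + ((n * (3 + 2) + 2) + 2))
     (\<lambda>m. wp (seqs (replicate k mul_n)) m (k * (2 + ((n * (3 + 2) + 2) + 2)))
     (\<lambda>(I', R'). R' = R \<and> I' 16 = I 16 * n ^ Suc k \<and> (\<forall>x. x \<notin> {10, 14, 15, 16} \<longrightarrow> I' x = I x)))"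
  proof (rule wp_mono[OF mul_n_wp[of I R, OF Suc.prems] order_refl], clarify)
    fix J S assume J: "J 16 = I 16 * n" "\<forall>x. x \<notin> {10, 14, 15, 16} \<longrightarrow> J x = I x"
    then have "J 0 = n" using Suc.prems by simp
    from Suc.IH[of J, OF this] show "wp (seqs (replicate k mul_n)) (J, R) (k * (2 + ((n * (3 + 2) + 2) + 2)))
     (\<lambda>(I', R'). R' = R \<and> I' 16 = I 16 * n ^ Suc k \<and> (\<forall>x. x \<notin> {10, 14, 15, 16} \<longrightarrow> I' x = I x))"
      by (rule wp_mono) (use J in auto)
  qed
  then show ?case by (simp only: replicate.simps seqs.simps mult_Suc) (rule wp_seq)
qed

lemma copy_points_wp:
  assumes "I 0 = n" "I 8 = 0" and R: "\<And>i c. i < n \<Longrightarrow> c < D \<Longrightarrow> R (i * D + c) = X i c"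
  shows "wp (copy_points D) (I, R) ((D + 10) + ((n * D - 3) * (5 + 2) + 2))
     (\<lambda>(I', R'). pts R' \<and> I' 7 = PB \<and> I' 8 = n * D \<and> (\<forall>x. x \<notin> {7, 8, 10, 14, 15} \<longrightarrow> I' x = I x))"
proof -
  let ?b = "replicate D (IAdd 8 8 0) @ [IConst 14 3, IAdd 7 8 14, RStore 7 0, IConst 14 1, IAdd 15 7 14,
        RStore 15 1, IAdd 15 15 14, RStore 15 2, IAdd 15 15 14, IConst 10 3]"
  let ?c = "[RLoad 0 10, RStore 15 0, IConst 14 1, IAdd 10 10 14, IAdd 15 15 14]"
  \<comment> \<open>Targets lie above all originals, so coordinates still to be copied survive. With
    at most three coordinates the truncated \<open>n * D - 3\<close> is 0 and the loop does
    nothing.\<close>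
  let ?Inv = "\<lambda>k (I', R'). I' 7 = PB \<and> I' 8 = n * D \<and> I' 10 = 3 + k \<and> I' 15 = PB + 3 + k
    \<and> (\<forall>a<3 + k. R' (PB + a) = R a) \<and> (\<forall>a. 3 \<le> a \<and> a < n * D \<longrightarrow> R' a = R a)
    \<and> (\<forall>x. x \<notin> {7, 8, 10, 14, 15} \<longrightarrow> I' x = I x)"
  have start: "?Inv 0 (fold eff ?b (I, R))"
  proof -
    define S where "S = R(PB := R 0, PB + 1 := R 1, PB + 2 := R 2)"
    have PB: "PB \<ge> 3" "PB = n * D + 3" by (simp_all add: PB_def)
    have "fold eff ?b (I, R) = (I(8 := n * D, 7 := PB, 14 := 1, 15 := PB + 3, 10 := 3), S)"
      using assms(1,2) PB(1) by (simp add: add_iterate S_def PB(2) mult.commute fun_upd_twist)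
    moreover have "S (PB + a) = R a" if "a < 3" for a
    proof -
      have "a = 0 \<or> a = 1 \<or> a = 2" using that by linarith
      then show ?thesis by (auto simp: S_def)
    qed
    moreover have "S a = R a" if "a < n * D" for a using that PB(2) by (simp add: S_def)
    ultimately show ?thesis by simp
  qed
  have "wp (While (ILess 10 8) (Block ?c)) (fold eff ?b (I, R)) ((n * D - 3) * (5 + 2) + 2) (?Inv (n * D - 3))"
  proof (rule wp_loop[where Inv = ?Inv])
    show "?Inv 0 (fold eff ?b (I, R))" by (rule start)
  next
    fix k m assume k: "k < n * D - 3" and m: "?Inv k m"
    obtain I1 R1 where m1: "m = (I1, R1)" by (cases m)
    have PB: "PB > n * D" "PB \<ge> 3" by (simp_all add: PB_def)
    define S where "S = R1(0 := R (3 + k), PB + 3 + k := R (3 + k))"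
    have k3: "R1 (3 + k) = R (3 + k)" using m k unfolding m1 by auto
    have I1: "I1 7 = PB" "I1 8 = n * D" "I1 10 = 3 + k" "I1 15 = PB + 3 + k"
      "\<And>x. x \<notin> {7, 8, 10, 14, 15} \<Longrightarrow> I1 x = I x" using m unfolding m1 by auto
    define J where "J = I1(14 := 1, 10 := 3 + Suc k, 15 := PB + 3 + Suc k)"
    have f: "fold eff ?c (I1, R1) = (J, S)"
      using I1(1-4) k3 by (simp add: S_def J_def fun_upd_twist)
    have "S (PB + a) = R a" if "a < 3 + Suc k" for a
      using m that PB unfolding m1 by (cases "a = 3 + k") (auto simp: S_def)
    moreover have "S a = R a" if "3 \<le> a" "a < n * D" for a
      using m that PB unfolding m1 by (auto simp: S_def)
    moreover have "J 7 = PB" "J 8 = n * D" "J 10 = 3 + Suc k" "J 15 = PB + 3 + Suc k"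
      "\<And>x. x \<notin> {7, 8, 10, 14, 15} \<Longrightarrow> J x = I x"
      using I1 by (simp_all add: J_def)
    ultimately have "?Inv (Suc k) (fold eff ?c (I1, R1))" unfolding f by simp
    then have "wp (Block ?c) m 5 (?Inv (Suc k))" unfolding m1 by (intro wp_blockI, simp, simp)
    moreover have "holds (ILess 10 8) m" using I1 k m1 by simp
    ultimately show "holds (ILess 10 8) m \<and> wp (Block ?c) m 5 (?Inv (Suc k))" by blast
  next
    fix m assume "?Inv (n * D - 3) m"
    then show "\<not> holds (ILess 10 8) m" by (cases m) auto
  qed
  moreover have "pts R'" if "\<forall>a<3 + (n * D - 3). R' (PB + a) = R a" for R'
    unfolding pts_def
  proof (intro allI impI)
    fix i c assume ic: "i < n" "c < D"
    have "Suc i * D \<le> n * D" using ic by (intro mult_right_mono) auto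
    then have "i * D + c < 3 + (n * D - 3)" using ic by simp
    then show "R' (PB + i * D + c) = X i c" using that R[OF ic] by (simp add: add.assoc)
  qed
  ultimately show ?thesis unfolding copy_points_def
    by (intro wp_seq, intro wp_blockI) (auto elim!: wp_mono)
qed

lemma setup_wp:
  assumes I: "\<And>x. I x = (if x = 0 then n else 0)"
    and R: "\<And>i c. i < n \<Longrightarrow> c < D \<Longrightarrow> R (i * D + c) = X i c"
  shows "wp (setup_code D (length cfgs)) (I, R) ((12 * D + 25) * (n + 1)) (\<lambda>m. represents {} m)"
proof -
  let ?b = "[IConst 14 (20 + D), IAdd 16 16 14, IConst 9 (20 + D), IConst 14 0, IAdd 2 16 14]"
  let ?P = "\<lambda>(I', R'). pts R' \<and> I' 7 = PB \<and> I' 8 = PB + n * D \<and> I' 16 = 2 * length cfgs * n ^ (D + 1)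
    \<and> (\<forall>x. x \<notin> {7, 8, 10, 14, 15, 16} \<longrightarrow> I' x = I x)"
  have fin: "wp (Block ?b) m 5 (\<lambda>m. represents {} m)" if "?P m" for m
  proof -
    obtain I1 R1 where m1: "m = (I1, R1)" by (cases m)
    define I2 where "I2 = fst (fold eff ?b (I1, R1))"
    have f: "fold eff ?b (I1, R1) = (I2, R1)" by (simp add: I2_def)
    have I2: "I2 2 = OB" "I2 16 = OB" "I2 9 = T0 + 2"
      using that unfolding m1 I2_def by (simp_all add: OB_def T0_def)
    have I2x: "I2 x = I1 x" if "x \<notin> {2, 9, 14, 16}" for x
      using that unfolding I2_def by simp
    have z: "I2 x = 0" if "x \<ge> T0" for x using \<open>?P m\<close> that I2x[of x] I[of x] unfolding m1 T0_def by auto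
    have "fixed I2" using that I2 I2x I[of 0] unfolding m1 fixed_def by auto
    \<comment> \<open>The trie with only its root is present from the start, as memory from
      \<open>T0\<close> on is 0.\<close>
    moreover have "trie T0 OB (pref {}) (\<lambda>_. T0) I2" unfolding trie_def pref_def using z by auto
    moreover have "store [] I2" using that I2 I2x[of 1] I[of 1] unfolding m1 store_def by auto
    ultimately have "represents {} (I2, R1)"
      using that I2 unfolding m1 by (intro representsI[of I2 R1 "[]" _ "\<lambda>_. T0"]) (auto simp: pref_def)
    then show ?thesis unfolding m1 by (intro wp_blockI, simp, simp, unfold f)
  qed
  have mul: "wp (seqs (replicate (D + 1) mul_n)) (fold eff [IAdd 8 7 8, IConst 16 (2 * length cfgs)] (I1, R1))
      ((D + 1) * (2 + ((n * (3 + 2) + 2) + 2))) ?P"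
    if "pts R1" "I1 7 = PB" "I1 8 = n * D" "\<forall>x. x \<notin> {7, 8, 10, 14, 15} \<longrightarrow> I1 x = I x" for I1 R1
  proof -
    define I2 where "I2 = I1(8 := PB + n * D, 16 := 2 * length cfgs)"
    have f: "fold eff [IAdd 8 7 8, IConst 16 (2 * length cfgs)] (I1, R1) = (I2, R1)"
      using that by (simp add: I2_def)
    have "I2 0 = n" using that I[of 0] by (simp add: I2_def)
    from muls_wp[of I2 "D + 1" R1, OF this] show ?thesis
      unfolding f by (rule wp_mono) (use that in \<open>auto simp: I2_def\<close>)
  qed
  have "wp (setup_code D (length cfgs)) (I, R)
    (((D + 10) + ((n * D - 3) * (5 + 2) + 2)) + (2 + ((D + 1) * (2 + ((n * (3 + 2) + 2) + 2)) + 5))) (\<lambda>m. represents {} m)"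
    unfolding setup_code_def
    apply (rule wp_seq, rule wp_mono[OF copy_points_wp order_refl])
    using I R apply (simp, simp, simp)
    apply (clarify, rule wp_seq, rule wp_blockI, simp, simp)
    apply (rule wp_seq, rule wp_mono[OF mul order_refl])
    using fin by auto
  \<comment> \<open>The 12 is 7 per copied coordinate plus 5 per pass of a multiplication.\<close>
  moreover have "((D + 10) + ((n * D - 3) * (5 + 2) + 2)) + (2 + ((D + 1) * (2 + ((n * (3 + 2) + 2) + 2)) + 5))
    \<le> (12 * D + 25) * (n + 1)"
  proof -
    have "(n * D - 3) * 7 \<le> 7 * (n * D)" by simp
    then show ?thesis by (simp add: algebra_simps)
  qed
  ultimately show ?thesis by (rule wp_mono)
qed

lemma wordsF_D: "wordsF D q = allw"
proof (intro subset_antisym subsetI)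
  fix x assume "x \<in> wordsF D q"
  then show "x \<in> allw" unfolding wordsF_def allw_def by blast
next
  fix x assume "x \<in> allw"
  then obtain cfg r where r: "x = word cfg r" "cfg \<in> set cfgs" "\<forall>j<D. r j < n" unfolding allw_def by blast
  have "word cfg r = word cfg (\<lambda>j. if j < D then r j else q j)" using r(2) by (rule word_cong) simp
  then show "x \<in> wordsF D q"
    using r unfolding wordsF_def
    by (intro CollectI exI[of _ cfg] exI[of _ "\<lambda>j. if j < D then r j else q j"]) auto
qed

lemma main_code_wp:
  assumes I: "\<And>x. I x = (if x = 0 then n else 0)"
    and R: "\<And>i c. i < n \<Longrightarrow> c < D \<Longrightarrow> R (i * D + c) = X i c"
  shows "wp (main_code D cfgs) (I, R) ((walks_time + 18 * D + 27) * (n + 1) ^ (D + 1)) (\<lambda>m. represents allw m)"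
proof -
  let ?n = "nest D (seqs (map (walk D) cfgs)) D"
  have "wp (setup_code D (length cfgs)) (I, R) ((12 * D + 25) * (n + 1)) (\<lambda>m. represents {} m)"
    using assms by (rule setup_wp)
  moreover have "wp ?n m ((walks_time + 6 * D) * (n + 1) ^ (D + 1)) (\<lambda>m. represents allw m)" if "represents {} m" for m
    by (rule wp_mono[OF nest_wp[of D "{}" m "\<lambda>_. 0"] order_refl])
      (use that in \<open>auto simp: vars_def wordsF_D\<close>)
  ultimately have "wp (Seq (setup_code D (length cfgs)) ?n) (I, R)
     ((12 * D + 25) * (n + 1) + (walks_time + 6 * D) * (n + 1) ^ (D + 1)) (\<lambda>m. represents allw m)"
    by (intro wp_seq, elim wp_mono[OF _ order_refl])
  then have "wp (main_code D cfgs) (I, R)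
     ((12 * D + 25) * (n + 1) + (walks_time + 6 * D) * (n + 1) ^ (D + 1) + 2) (\<lambda>m. represents allw m)"
    unfolding main_code_def using I n by (intro wp_cond) auto
  moreover have "(12 * D + 25) * (n + 1) + (walks_time + 6 * D) * (n + 1) ^ (D + 1) + 2
    \<le> (walks_time + 18 * D + 27) * (n + 1) ^ (D + 1)"
  proof -
    have "n + 1 \<le> (n + 1) ^ (D + 1)" using power_increasing[of 1 "D + 1" "n + 1"] by simp
    then have "(12 * D + 25) * (n + 1) \<le> (12 * D + 25) * (n + 1) ^ (D + 1)" by (rule mult_le_mono2)
    moreover have "2 \<le> 2 * (n + 1) ^ (D + 1)" using one_le_power[of "n + 1" "D + 1"] by linarith
    moreover have "(walks_time + 18 * D + 27) * (n + 1) ^ (D + 1) = (12 * D + 25) * (n + 1) ^ (D + 1)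
       + (walks_time + 6 * D) * (n + 1) ^ (D + 1) + 2 * (n + 1) ^ (D + 1)" by (simp add: add_mult_distrib)
    ultimately show ?thesis by linarith
  qed
  ultimately show ?thesis by (rule wp_mono)
qed

end

section \<open>The cells of the arrangement\<close>

text \<open>Take \<open>t = v + e u\<close> with small \<open>e > 0\<close>: strict inequalities at
  \<open>v\<close> persist, and on tight hyperplanes the sign of \<open>a j \<bullet> u\<close>
  decides. Finitely many conditions share one \<open>e\<close>. This realises every candidate by a
  translate.\<close>

lemma exists_perturbation:
  fixes a :: "'i \<Rightarrow> 'a::euclidean_space" and h :: "'i \<Rightarrow> 'p \<Rightarrow> real"
  assumes "finite J" "finite P"
  shows "\<exists>t. \<forall>j\<in>J. \<forall>p\<in>P. h j p < a j \<bullet> t \<longleftrightarrow> h j p < a j \<bullet> v \<or> (h j p = a j \<bullet> v \<and> 0 < a j \<bullet> u)"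
proof -
  let ?ok = "\<lambda>j p e. h j p < a j \<bullet> (v + e *\<^sub>R u) \<longleftrightarrow> h j p < a j \<bullet> v \<or> (h j p = a j \<bullet> v \<and> 0 < a j \<bullet> u)"
  have "eventually (?ok j p) (at_right 0)" for j p
  proof -
    have lim: "((\<lambda>e. a j \<bullet> (v + e *\<^sub>R u)) \<longlongrightarrow> a j \<bullet> (v + 0 *\<^sub>R u)) (at_right 0)"
      by (intro tendsto_intros)
    consider "h j p < a j \<bullet> v" | "h j p > a j \<bullet> v" | "h j p = a j \<bullet> v" by linarith
    then show ?thesis
    proof cases
      case 1
      then have "eventually (\<lambda>e. h j p < a j \<bullet> (v + e *\<^sub>R u)) (at_right 0)"
        using order_tendstoD(1)[OF lim, of "h j p"] by simp
      then show ?thesis using 1 by (auto elim: eventually_mono)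
    next
      case 2
      then have "eventually (\<lambda>e. h j p > a j \<bullet> (v + e *\<^sub>R u)) (at_right 0)"
        using order_tendstoD(2)[OF lim, of "h j p"] by simp
      then show ?thesis using 2 by (auto elim: eventually_mono)
    next
      case 3
      have "eventually (\<lambda>e. e > 0) (at_right (0::real))" by (rule eventually_at_right_less)
      then show ?thesis using 3 by (auto elim!: eventually_mono simp: inner_add_right zero_less_mult_iff)
    qed
  qed
  then have "eventually (\<lambda>e. \<forall>j\<in>J. \<forall>p\<in>P. ?ok j p e) (at_right (0::real))"
    using assms by (intro eventually_ball_finite ballI)
  then obtain e where "\<forall>j\<in>J. \<forall>p\<in>P. ?ok j p e"
    using eventually_happens'[OF trivial_limit_at_right_real] by blast
  then show ?thesis by blast
qed

text \<open>The component of \<open>x\<close> orthogonal to \<open>span S\<close> serves as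
  \<open>w\<close>.\<close>

lemma exists_orthogonal_witness:
  fixes x :: "'a::euclidean_space"
  assumes "x \<notin> span S"
  shows "\<exists>w. (\<forall>y\<in>S. y \<bullet> w = 0) \<and> x \<bullet> w \<noteq> 0"
proof -
  obtain y z where yz: "y \<in> span S" "\<And>w. w \<in> span S \<Longrightarrow> orthogonal z w" "x = y + z"
    using orthogonal_subspace_decomp_exists[of S x] by metis
  have "z \<noteq> 0" using yz assms by auto
  moreover have "y \<bullet> z = 0" using yz(2)[OF yz(1)] by (simp add: orthogonal_def inner_commute)
  ultimately have "x \<bullet> z \<noteq> 0" by (simp add: yz(3) inner_add_left)
  moreover have "\<forall>s\<in>S. s \<bullet> z = 0"
    using yz(2) span_base by (auto simp: orthogonal_def inner_commute)
  ultimately show ?thesis by blast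
qed

text \<open>Among the points of the closure of the face of \<open>t\<close>, take one with the maximal number of tight
  hyperplanes: if their normals did not span, moving orthogonally to them would hit another one.\<close>

lemma exists_full_rank_point:
  fixes a :: "'i \<Rightarrow> 'a::euclidean_space" and h :: "'i \<Rightarrow> 'p \<Rightarrow> real"
  assumes J: "finite J" and P: "finite P" "P \<noteq> {}"
  shows "\<exists>v. (\<forall>j\<in>J. \<forall>p\<in>P. (h j p < a j \<bullet> t \<longrightarrow> h j p \<le> a j \<bullet> v) \<and> (a j \<bullet> t \<le> h j p \<longrightarrow> a j \<bullet> v \<le> h j p))
    \<and> a ` J \<subseteq> span (a ` {j\<in>J. \<exists>p\<in>P. a j \<bullet> v = h j p})"
proof -
  define Q where "Q v \<longleftrightarrow> (\<forall>j\<in>J. \<forall>p\<in>P. (h j p < a j \<bullet> t \<longrightarrow> h j p \<le> a j \<bullet> v) \<and> (a j \<bullet> t \<le> h j p \<longrightarrow> a j \<bullet> v \<le> h j p))" for v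
  define T where "T v = {(j, p) \<in> J \<times> P. a j \<bullet> v = h j p}" for v
  have T: "T v \<subseteq> J \<times> P" for v unfolding T_def by auto
  have fin: "finite (J \<times> P)" using J P by simp
  let ?R = "\<lambda>k. \<exists>v. Q v \<and> card (T v) = k"
  have "?R (card (T t))" unfolding Q_def by (intro exI[of _ t]) auto
  moreover have "\<forall>k. ?R k \<longrightarrow> k \<le> card (J \<times> P)"
    using card_mono[OF fin T] by auto
  ultimately have "\<exists>k. ?R k \<and> (\<forall>k'. ?R k' \<longrightarrow> k' \<le> k)"
    by (rule Nat.ex_has_greatest_nat)
  then obtain v where v: "Q v" and max: "\<And>v'. Q v' \<Longrightarrow> card (T v') \<le> card (T v)"
    by auto
  have "a j \<in> span (a ` {j\<in>J. \<exists>p\<in>P. a j \<bullet> v = h j p})" if j: "j \<in> J" for j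
  proof (rule ccontr)
    let ?S = "a ` {j\<in>J. \<exists>p\<in>P. a j \<bullet> v = h j p}"
    assume "a j \<notin> span ?S"
    moreover from this have nt: "a j \<bullet> v \<noteq> h j p" if "p \<in> P" for p
      using j that span_base[of "a j" ?S] by auto
    ultimately obtain w where w: "\<forall>y\<in>?S. y \<bullet> w = 0" "a j \<bullet> w \<noteq> 0"
      using exists_orthogonal_witness by blast
    obtain p0 where p0: "p0 \<in> P" using P by blast
    \<comment> \<open>Scaled so that \<open>v + w'\<close> lies on the hyperplane of
      \<open>(j, p0)\<close>; thus some hyperplane is hit at a positive time.\<close>
    define w' where "w' = ((h j p0 - a j \<bullet> v) / (a j \<bullet> w)) *\<^sub>R w"
    have w': "a i \<bullet> w' = 0" if "i \<in> J" "p \<in> P" "a i \<bullet> v = h i p" for i p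
      using w(1) that unfolding w'_def by auto
    have jw': "a j \<bullet> w' = h j p0 - a j \<bullet> v" using w(2) by (simp add: w'_def)
    \<comment> \<open>The time at which the ray from \<open>v\<close> in direction \<open>w'\<close>
      meets the hyperplane of \<open>(i, p)\<close>. Stopping at the least positive one crosses
      nothing.\<close>
    define s where "s i p = (h i p - a i \<bullet> v) / (a i \<bullet> w')" for i p
    define X where "X = {s i p | i p. (i, p) \<in> J \<times> P \<and> a i \<bullet> w' \<noteq> 0 \<and> 0 < s i p}"
    have "X \<subseteq> (\<lambda>(i, p). s i p) ` (J \<times> P)" unfolding X_def by auto
    then have "finite X" using fin finite_surj by blast
    moreover have "s j p0 \<in> X"
    proof -
      have "a j \<bullet> w' \<noteq> 0" "s j p0 = 1" using nt[OF p0] unfolding s_def jw' by auto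
      then show ?thesis using j p0 unfolding X_def by force
    qed
    ultimately have "finite X" "X \<noteq> {}" by blast+
    then have X: "Min X \<in> X" "\<And>y. y \<in> X \<Longrightarrow> Min X \<le> y"
      using Min_in[of X] Min_le[of X] by blast+
    obtain j1 p1 where 1: "(j1, p1) \<in> J \<times> P" "a j1 \<bullet> w' \<noteq> 0" "0 < s j1 p1" "Min X = s j1 p1"
      using X(1) unfolding X_def by auto
    define v' where "v' = v + Min X *\<^sub>R w'"
    have diff: "a i \<bullet> v' - h i p = (Min X - s i p) * (a i \<bullet> w') \<and> a i \<bullet> v - h i p = - s i p * (a i \<bullet> w')"
      if "a i \<bullet> w' \<noteq> 0" for i p
      using that by (simp add: v'_def s_def inner_add_right field_simps)
    have weak: "(h i p < a i \<bullet> v \<longrightarrow> h i p \<le> a i \<bullet> v') \<and> (a i \<bullet> v < h i p \<longrightarrow> a i \<bullet> v' \<le> h i p)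
       \<and> (a i \<bullet> v = h i p \<longrightarrow> a i \<bullet> v' = h i p)" if ip: "i \<in> J" "p \<in> P" for i p
    proof (cases "a i \<bullet> w' = 0")
      case True
      then show ?thesis by (simp add: v'_def inner_add_right)
    next
      case False
      have ne: "a i \<bullet> v \<noteq> h i p" using False w'[OF ip] by auto
      then have s0: "s i p \<noteq> 0" using False by (simp add: s_def)
      have "s i p < 0 \<or> Min X \<le> s i p"
        using s0 X(2)[of "s i p"] ip False unfolding X_def by force
      then have pos: "0 \<le> (Min X - s i p) * (- s i p)"
        using 1(3,4) by (auto simp: mult_le_0_iff zero_le_mult_iff)
      \<comment> \<open>A nonnegative product means that \<open>v\<close> and \<open>v'\<close> lie
        weakly on the same side. Up to a square it is \<open>(Min X - s i p) * (- s i p)\<close>,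
        where \<open>s i p\<close> is negative or at least \<open>Min X\<close>.\<close>
      have "0 \<le> (a i \<bullet> v' - h i p) * (a i \<bullet> v - h i p)"
      proof -
        have "(a i \<bullet> v' - h i p) * (a i \<bullet> v - h i p) = ((Min X - s i p) * (- s i p)) * (a i \<bullet> w')\<^sup>2"
          unfolding conjunct1[OF diff[OF False, of p]] conjunct2[OF diff[OF False, of p]]
          by (simp add: power2_eq_square)
        then show ?thesis using mult_nonneg_nonneg[OF pos, of "(a i \<bullet> w')\<^sup>2"] by simp
      qed
      then show ?thesis using ne by (auto simp: zero_le_mult_iff)
    qed
    have "Q v'"
      unfolding Q_def
    proof (intro ballI)
      fix i p assume ip: "i \<in> J" "p \<in> P"
      show "(h i p < a i \<bullet> t \<longrightarrow> h i p \<le> a i \<bullet> v') \<and> (a i \<bullet> t \<le> h i p \<longrightarrow> a i \<bullet> v' \<le> h i p)"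
        using v[unfolded Q_def, rule_format, OF ip] weak[OF ip] by linarith
    qed
    \<comment> \<open>Old tight pairs stay tight since \<open>w'\<close> is orthogonal to their
      normals, and \<open>(j1, p1)\<close> joins them, against maximality.\<close>
    moreover have "T v \<subset> T v'"
    proof (rule psubsetI)
      show "T v \<subseteq> T v'" using weak unfolding T_def by auto
      have "(j1, p1) \<in> T v'" using 1 diff[OF 1(2), of p1] unfolding T_def by auto
      moreover have "(j1, p1) \<notin> T v" using 1 w' unfolding T_def by auto
      ultimately show "T v \<noteq> T v'" by blast
    qed
    then have "card (T v) < card (T v')"
      by (intro psubset_card_mono) (rule finite_subset[OF T fin])
    ultimately show False using max[of v'] by simp
  qed
  then show ?thesis using v unfolding Q_def by blast
qed

text \<open>Lists, because the k-th basis row is paired with the k-th point of a tuple. Distinctness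
  is asked of the normals, since different rows may share one.\<close>

definition bases :: "('i \<Rightarrow> 'a::euclidean_space) \<Rightarrow> 'i set \<Rightarrow> 'i list set" where
  "bases a J = {bl. set bl \<subseteq> J \<and> distinct (map a bl) \<and> independent (set (map a bl))
     \<and> a ` J \<subseteq> span (set (map a bl))}"

lemma finite_bases: "finite J \<Longrightarrow> finite (bases a J)"
  by (rule finite_subset[OF _ finite_subset_distinct[of J]]) (auto simp: bases_def distinct_map)

lemma length_bases: "bl \<in> bases (a :: 'i \<Rightarrow> 'a::euclidean_space) J \<Longrightarrow> length bl \<le> DIM('a)"
  using independent_bound[of "set (map a bl)"] distinct_card[of "map a bl"]
  unfolding bases_def by simp

lemma exists_basis:
  assumes "K \<subseteq> J" "finite K" "a ` J \<subseteq> span (a ` K)"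
  shows "\<exists>bl\<in>bases a J. set bl \<subseteq> K"
proof -
  obtain B where B: "B \<subseteq> a ` K" "independent B" "a ` K \<subseteq> span B"
    by (rule maximal_independent_subset)
  obtain K' where K': "K' \<subseteq> K" "inj_on a K'" "B = a ` K'"
    using B(1) by (meson subset_image_inj)
  then obtain bl where bl: "set bl = K'" "distinct bl"
    using assms(2) finite_distinct_list finite_subset by metis
  have "a ` J \<subseteq> span B" using assms(3) B(3) span_mono[OF B(3)] by (auto simp: span_span)
  then have "bl \<in> bases a J" using bl K' B assms(1) unfolding bases_def by (auto simp: distinct_map)
  then show ?thesis using bl K' by blast
qed

text \<open>The coefficients depend on the rows and the basis but not on the points, so the program
  can contain them as constants.\<close>

lemma bases_coefficients:
  assumes "bl \<in> bases a J"
  shows "\<exists>l. \<forall>j\<in>J. a j = (\<Sum>k<length bl. l j k *\<^sub>R a (bl ! k))"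
proof -
  have "\<exists>l. a j = (\<Sum>k<length bl. l k *\<^sub>R a (bl ! k))" if "j \<in> J" for j
  proof -
    have "a j \<in> span (set (map a bl))" using assms that unfolding bases_def by auto
    then obtain u where "a j = (\<Sum>v\<in>set (map a bl). u v *\<^sub>R v)"
      by (auto simp: span_finite)
    also have "\<dots> = (\<Sum>k<length bl. u (map a bl ! k) *\<^sub>R (map a bl ! k))"
      using assms unfolding bases_def
      by (intro sum.reindex_bij_betw[symmetric] bij_betw_nth) auto
    also have "\<dots> = (\<Sum>k<length bl. u (a (bl ! k)) *\<^sub>R a (bl ! k))" by simp
    finally show ?thesis by (rule exI[of _ "\<lambda>k. u (a (bl ! k))"])
  qed
  then have "\<forall>j\<in>J. \<exists>l. a j = (\<Sum>k<length bl. l k *\<^sub>R a (bl ! k))" by blast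
  then show ?thesis by (rule bchoice)
qed

text \<open>Values on independent vectors extend to a linear functional, which is the inner product
  with a vector. Since the \<open>y k\<close> are arbitrary, every tuple of points defines some
  \<open>v\<close>.\<close>

lemma bases_point:
  assumes "bl \<in> bases a J"
  shows "\<exists>v. \<forall>k<length bl. a (bl ! k) \<bullet> v = y k"
proof -
  let ?xs = "map a bl"
  have d: "distinct ?xs" "independent (set ?xs)" using assms unfolding bases_def by auto
  have inj: "inj_on ((!) ?xs) {..<length bl}" using inj_on_nth[OF d(1)] by auto
  obtain g :: "'b \<Rightarrow> real" where g: "linear g" "\<forall>x\<in>set ?xs. g x = y (the_inv_into {..<length bl} ((!) ?xs) x)"
    using linear_independent_extend[OF d(2), of "\<lambda>x. y (the_inv_into {..<length bl} ((!) ?xs) x)"] by auto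
  have "a (bl ! k) \<bullet> adjoint g 1 = y k" if "k < length bl" for k
  proof -
    have "g (?xs ! k) = y k"
      using g(2) that the_inv_into_f_f[OF inj, of k] nth_mem[of k ?xs] by simp
    then show ?thesis using adjoint_works[OF g(1)] that by simp
  qed
  then show ?thesis by blast
qed


section \<open>From the window to affine constraints\<close>

lemma interior_polywin:
  fixes A :: "real^'d^'l" and b :: "real^'l"
  assumes "\<And>j. A $ j = 0 \<Longrightarrow> b $ j \<ge> 0"
  shows "interior (polywin A b) = {x. \<forall>j. A $ j \<noteq> 0 \<longrightarrow> A $ j \<bullet> x < b $ j}"
proof -
  have interior_INT: "interior (\<Inter>j\<in>J. F j) = (\<Inter>j\<in>J. interior (F j))"
    if "finite J" for J :: "'l set" and F :: "'l \<Rightarrow> (real^'d) set"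
    using that by induction auto
  \<comment> \<open>For a zero row the halfspace is everything thanks to
    \<open>b $ j \<ge> 0\<close>; with a negative bound it would be empty.\<close>
  have "interior {x. A $ j \<bullet> x \<le> b $ j} = {x. A $ j \<noteq> 0 \<longrightarrow> A $ j \<bullet> x < b $ j}" for j
    using assms[of j] by (cases "A $ j = 0") simp_all
  moreover have "polywin A b = (\<Inter>j\<in>UNIV. {x. A $ j \<bullet> x \<le> b $ j})"
    unfolding polywin_def by (auto simp: matrix_vector_mul_component)
  ultimately show ?thesis by (auto simp: interior_INT)
qed

lemma mem_S_win_iff: "p \<in> S_win W t P \<longleftrightarrow> p \<in> P \<and> p - t \<in> W"
proof -
  have "p \<in> (\<lambda>w. t + w) ` W \<longleftrightarrow> p - t \<in> W"
    by (metis (no_types, lifting) add_diff_cancel_left' diff_add_cancel add.commute image_iff)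
  then show ?thesis unfolding S_win_def by simp
qed

text \<open>For a basis \<open>bl\<close> of the row space and points \<open>z 0, z 1, \<dots>\<close>, let \<open>v\<close> be a solution of
  \<open>a (bl ! k) \<bullet> v = a (bl ! k) \<bullet> z k - b (bl ! k)\<close>. Then \<open>a j \<bullet> v\<close> is an affine function of the
  coordinates of these points, so that no linear system is solved at run time. The sign vector \<open>\<sigma>\<close>
  describes an infinitesimal displacement of \<open>v\<close>, and \<open>z CARD('d)\<close> is the point to be tested.\<close>

definition constraint_of ::
  "(nat \<Rightarrow> 'd) \<Rightarrow> real^'d^'l \<Rightarrow> real^'l \<Rightarrow> ('l \<Rightarrow> nat \<Rightarrow> real) \<Rightarrow> 'l list \<Rightarrow> ('l \<Rightarrow> bool) \<Rightarrow> 'l \<Rightarrow> constraint" where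
  "constraint_of enc A b l bl \<sigma> j =
     (b $ j - (\<Sum>k\<leftarrow>[0..<length bl]. l j k * b $ (bl ! k)),
      concat (map (\<lambda>k. map (\<lambda>c. (k, c, l j k * A $ (bl ! k) $ enc c)) [0..<CARD('d)]) [0..<length bl])
        @ map (\<lambda>c. (CARD('d), c, - A $ j $ enc c)) [0..<CARD('d)],
      \<not> \<sigma> j)"

lemma sum_list_concat_map: "sum_list (map f (concat xss)) = (\<Sum>xs\<leftarrow>xss. sum_list (map f xs))"
  by (induction xss) auto

text \<open>The affine form evaluates to \<open>y - h\<close>. The strict test is relaxed to a weak
  one exactly when the displacement moves to the positive side, where a tight hyperplane counts as
  satisfied.\<close>

lemma sat_constraint_of:
  fixes A :: "real^'d^'l" and z :: "nat \<Rightarrow> real^'d"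
  assumes enc: "bij_betw enc {..<CARD('d)} UNIV"
  shows "sat (\<lambda>k c. z k $ enc c) (constraint_of enc A b l bl \<sigma> j) \<longleftrightarrow>
    (let y = \<Sum>k<length bl. l j k * (A $ (bl ! k) \<bullet> z k - b $ (bl ! k)); h = A $ j \<bullet> z CARD('d) - b $ j
     in h < y \<or> (h = y \<and> \<sigma> j))"
proof -
  have inner: "(\<Sum>c<CARD('d). x $ enc c * y $ enc c) = x \<bullet> y" for x y :: "real^'d"
    unfolding inner_vec_def using sum.reindex_bij_betw[OF enc, of "\<lambda>i. x $ i * y $ i"] by simp
  have sl: "(\<Sum>k\<leftarrow>[0..<m]. f k) = (\<Sum>k<m. f k)" for m and f :: "nat \<Rightarrow> real"
    by (simp add: interv_sum_list_conv_sum_set_nat atLeast0LessThan)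
  have "(\<Sum>(k, c, a)\<leftarrow>concat (map (\<lambda>k. map (\<lambda>c. (k, c, l j k * A $ (bl ! k) $ enc c)) [0..<CARD('d)]) [0..<length bl])
        @ map (\<lambda>c. (CARD('d), c, - A $ j $ enc c)) [0..<CARD('d)]. a * z k $ enc c)
    = (\<Sum>k<length bl. l j k * (A $ (bl ! k) \<bullet> z k)) - A $ j \<bullet> z CARD('d)"
    by (simp add: sum_list_concat_map comp_def sl sum_negf inner[symmetric] sum_distrib_left mult.assoc)
  then show ?thesis
    unfolding constraint_of_def
    by (auto simp: Let_def sl right_diff_distrib sum_subtractf simp del: map_append)
qed

lemma valid_constraint_of:
  "length bl \<le> CARD('d) \<Longrightarrow> valid CARD('d) (constraint_of enc (A :: real^'d^'l) b l bl \<sigma> j)"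
  unfolding valid_def constraint_of_def by auto

text \<open>The configurations are chosen before the points, so they can be compiled into the
  program; only the tuple \<open>q\<close> is enumerated at run time.\<close>

lemma Sep_eq_candidates:
  fixes A :: "real^'d^'l" and b :: "real^'l" and enc :: "nat \<Rightarrow> 'd"
  assumes enc: "bij_betw enc {..<CARD('d)} UNIV"
  shows "\<exists>cfgs :: constraint list list.
    (\<forall>cfg\<in>set cfgs. \<forall>cn\<in>set cfg. valid CARD('d) cn) \<and>
    (\<forall>ps. ps \<noteq> [] \<longrightarrow> Sep (interior (polywin A b)) (set ps) =
      {{ps ! p | p. p < length ps \<and> (\<forall>cn\<in>set cfg. sat (\<lambda>k c. ps ! ((q(CARD('d) := p)) k) $ enc c) cn)}
        | cfg q. cfg \<in> set cfgs \<and> (\<forall>k<CARD('d). q k < length ps)})"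
proof (cases "\<exists>j. A $ j = 0 \<and> b $ j < 0")
  case True
  then have "polywin A b = {}" unfolding polywin_def by (auto simp: matrix_vector_mul_component) (metis inner_zero_left not_le)
  then have "Sep (interior (polywin A b)) P = {{}}" for P
    unfolding Sep_def S_win_def by simp
  moreover have "\<exists>q. \<forall>k<CARD('d). q k < length ps" if "ps \<noteq> []" for ps :: "(real^'d) list"
    using that by (intro exI[of _ "\<lambda>_. 0"]) simp
  \<comment> \<open>The window is empty, and the unsatisfiable constraint \<open>0 < -1\<close>
    produces the empty set as only candidate.\<close>
  ultimately show ?thesis
    by (intro exI[of _ "[[(-1, [], True)]]"]) (auto simp: valid_def)
next
  case False
  define a where "a j = A $ j" for j
  define J where "J = {j. a j \<noteq> 0}"
  have W: "interior (polywin A b) = {x. \<forall>j\<in>J. a j \<bullet> x < b $ j}"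
    using interior_polywin[of A b] False unfolding J_def a_def by (auto simp: not_less)
  define L where "L bl = (SOME l. \<forall>j\<in>J. a j = (\<Sum>k<length bl. l j k *\<^sub>R a (bl ! k)))" for bl
  have L: "a j = (\<Sum>k<length bl. L bl j k *\<^sub>R a (bl ! k))" if "bl \<in> bases a J" "j \<in> J" for bl j
    using someI_ex[OF bases_coefficients[OF that(1)]] that(2) unfolding L_def by blast
  obtain js where js: "set js = J" using finite_list[of J] by auto
  define G where "G = (\<lambda>(bl, \<sigma>). map (constraint_of enc A b (L bl) bl \<sigma>) js)
    ` (bases a J \<times> range (\<lambda>u j. 0 < a j \<bullet> u))"
  have "finite G" unfolding G_def using finite_bases[of J a] by simp
  then obtain cfgs where cfgs: "set cfgs = G" using finite_list by auto
  have valid: "\<forall>cfg\<in>set cfgs. \<forall>cn\<in>set cfg. valid CARD('d) cn"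
    unfolding cfgs G_def using length_bases[of _ a J] by (auto intro!: valid_constraint_of)
  have "Sep (interior (polywin A b)) (set ps) =
      {{ps ! p | p. p < length ps \<and> (\<forall>cn\<in>set cfg. sat (\<lambda>k c. ps ! ((q(CARD('d) := p)) k) $ enc c) cn)}
        | cfg q. cfg \<in> set cfgs \<and> (\<forall>k<CARD('d). q k < length ps)}" (is "?S = ?C")
    if ps: "ps \<noteq> []" for ps
  proof -
    define h where "h j p = a j \<bullet> p - b $ j" for j and p :: "real^'d"
    have mem: "p \<in> S_win (interior (polywin A b)) t (set ps) \<longleftrightarrow> p \<in> set ps \<and> (\<forall>j\<in>J. h j p < a j \<bullet> t)" for p t
      unfolding mem_S_win_iff W h_def by (auto simp: inner_diff_right algebra_simps)
    have cand: "{ps ! p | p. p < length ps \<and> (\<forall>cn\<in>set (map (constraint_of enc A b (L bl) bl (\<lambda>j. 0 < a j \<bullet> u)) js).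
          sat (\<lambda>k c. ps ! ((q(CARD('d) := p)) k) $ enc c) cn)}
        = {x \<in> set ps. \<forall>j\<in>J. h j x < a j \<bullet> v \<or> (h j x = a j \<bullet> v \<and> 0 < a j \<bullet> u)}"
      if bl: "bl \<in> bases a J" and v: "\<And>k. k < length bl \<Longrightarrow> a (bl ! k) \<bullet> v = h (bl ! k) (ps ! q k)" for bl q u v
    proof -
      have len: "length bl \<le> CARD('d)" using length_bases[OF bl] by simp
      have "sat (\<lambda>k c. ps ! ((q(CARD('d) := p)) k) $ enc c) (constraint_of enc A b (L bl) bl (\<lambda>j. 0 < a j \<bullet> u) j)
          \<longleftrightarrow> h j (ps ! p) < a j \<bullet> v \<or> (h j (ps ! p) = a j \<bullet> v \<and> 0 < a j \<bullet> u)" if "j \<in> J" for p j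
      proof -
        have "(\<Sum>k<length bl. L bl j k * (A $ (bl ! k) \<bullet> ps ! ((q(CARD('d) := p)) k) - b $ (bl ! k)))
            = (\<Sum>k<length bl. L bl j k * (a (bl ! k) \<bullet> v))"
          using v len unfolding h_def by (intro sum.cong) (auto simp: a_def)
        also have "\<dots> = a j \<bullet> v"
          using arg_cong[OF L[OF bl that], of "\<lambda>x. x \<bullet> v"] by (simp add: inner_sum_left)
        finally show ?thesis
          using sat_constraint_of[OF enc, of "\<lambda>k. ps ! ((q(CARD('d) := p)) k)" A b "L bl" bl "\<lambda>j. 0 < a j \<bullet> u" j]
          by (simp only: Let_def h_def a_def fun_upd_same)
      qed
      then show ?thesis using js by (auto simp: in_set_conv_nth simp del: fun_upd_apply)
    qed
    show ?thesis
    proof (intro subset_antisym subsetI)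
      fix S assume "S \<in> ?S"
      then obtain t where t: "S = S_win (interior (polywin A b)) t (set ps)" unfolding Sep_def by blast
      obtain v where v: "\<And>j p. j \<in> J \<Longrightarrow> p \<in> set ps \<Longrightarrow> (h j p < a j \<bullet> t \<longrightarrow> h j p \<le> a j \<bullet> v) \<and> (a j \<bullet> t \<le> h j p \<longrightarrow> a j \<bullet> v \<le> h j p)"
        "a ` J \<subseteq> span (a ` {j\<in>J. \<exists>p\<in>set ps. a j \<bullet> v = h j p})"
        using exists_full_rank_point[of J "set ps" h a t] ps by auto
      obtain bl where bl: "bl \<in> bases a J" "set bl \<subseteq> {j\<in>J. \<exists>p\<in>set ps. a j \<bullet> v = h j p}"
        using exists_basis[OF _ _ v(2)] by auto
      \<comment> \<open>Positions beyond the basis receive any valid index, available because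
        \<open>ps\<close> is nonempty.\<close>
      have "\<exists>i<length ps. k < length bl \<longrightarrow> a (bl ! k) \<bullet> v = h (bl ! k) (ps ! i)" for k
        using bl(2) ps nth_mem[of k bl] by (cases "k < length bl") (fastforce simp: in_set_conv_nth)+
      then obtain q where q: "\<And>k. q k < length ps" "\<And>k. k < length bl \<Longrightarrow> a (bl ! k) \<bullet> v = h (bl ! k) (ps ! q k)"
        by metis
      \<comment> \<open>With displacement \<open>t - v\<close>, tight hyperplanes are decided as at
        \<open>t\<close>; at the others \<open>v\<close> lies strictly on the side of
        \<open>t\<close>, being in the closure of its face.\<close>
      have "S = {x \<in> set ps. \<forall>j\<in>J. h j x < a j \<bullet> v \<or> (h j x = a j \<bullet> v \<and> 0 < a j \<bullet> (t - v))}"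
      proof -
        have "h j p < a j \<bullet> t \<longleftrightarrow> h j p < a j \<bullet> v \<or> (h j p = a j \<bullet> v \<and> 0 < a j \<bullet> (t - v))" if "j \<in> J" "p \<in> set ps" for j p
          using v(1)[OF that] by (auto simp: inner_diff_right)
        then show ?thesis unfolding t set_eq_iff mem mem_Collect_eq by (intro allI conj_cong refl ball_cong)
      qed
      also note cand[of bl v q "t - v", OF bl(1) q(2), symmetric]
      finally have S: "S = {ps ! p | p. p < length ps \<and>
            (\<forall>cn\<in>set (map (constraint_of enc A b (L bl) bl (\<lambda>j. 0 < a j \<bullet> (t - v))) js).
              sat (\<lambda>k c. ps ! ((q(CARD('d) := p)) k) $ enc c) cn)}" .
      show "S \<in> ?C"
      proof -
        have "map (constraint_of enc A b (L bl) bl (\<lambda>j. 0 < a j \<bullet> (t - v))) js \<in> set cfgs"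
          unfolding cfgs G_def
          by (rule image_eqI[of _ _ "(bl, \<lambda>j. 0 < a j \<bullet> (t - v))"]) (use bl(1) in auto)
        moreover have "\<forall>k<CARD('d). q k < length ps" using q(1) by blast
        moreover note S
        ultimately show ?thesis by (intro CollectI exI conjI)
      qed
    next
      fix S assume "S \<in> ?C"
      then obtain cfg q where cfg: "cfg \<in> G" "\<forall>k<CARD('d). q k < length ps"
        "S = {ps ! p | p. p < length ps \<and> (\<forall>cn\<in>set cfg. sat (\<lambda>k c. ps ! ((q(CARD('d) := p)) k) $ enc c) cn)}"
        unfolding cfgs by blast
      then obtain bl u where "bl \<in> bases a J" "cfg = map (constraint_of enc A b (L bl) bl (\<lambda>j. 0 < a j \<bullet> u)) js"
        unfolding G_def by auto
      with cfg(3) have S: "bl \<in> bases a J"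
        "S = {ps ! p | p. p < length ps \<and> (\<forall>cn\<in>set (map (constraint_of enc A b (L bl) bl (\<lambda>j. 0 < a j \<bullet> u)) js).
          sat (\<lambda>k c. ps ! ((q(CARD('d) := p)) k) $ enc c) cn)}"
        by simp_all
      obtain v where v: "\<And>k. k < length bl \<Longrightarrow> a (bl ! k) \<bullet> v = h (bl ! k) (ps ! q k)"
        using bases_point[OF S(1), of "\<lambda>k. h (bl ! k) (ps ! q k)"] by blast
      have S_eq: "S = {x \<in> set ps. \<forall>j\<in>J. h j x < a j \<bullet> v \<or> (h j x = a j \<bullet> v \<and> 0 < a j \<bullet> u)}"
        unfolding S(2) using S(1) v by (rule cand)
      obtain t where "\<forall>j\<in>J. \<forall>p\<in>set ps. h j p < a j \<bullet> t \<longleftrightarrow> h j p < a j \<bullet> v \<or> (h j p = a j \<bullet> v \<and> 0 < a j \<bullet> u)"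
        using exists_perturbation[of J "set ps" h a v u] by auto
      then have "S = S_win (interior (polywin A b)) t (set ps)"
        unfolding S_eq set_eq_iff mem mem_Collect_eq
        by (intro allI conj_cong refl ball_cong) simp
      then show "S \<in> ?S" unfolding Sep_def by blast
    qed
  qed
  then show ?thesis using valid by blast
qed

section \<open>The machine program and its output\<close>

theorem theorem4p15:
  fixes A :: "real^'d^'l" and b :: "real^'l" and enc :: "nat \<Rightarrow> 'd"
  assumes "bij_betw enc {..<CARD('d)} UNIV"
  shows "\<exists>prog :: instr list. \<exists>C :: real.
           \<forall>ps :: (real^'d) list. distinct ps \<longrightarrow>
             (\<exists>t. real t \<le> C * real (length ps + 1) ^ (CARD('d) + 1) \<and>
                  halted prog ((step prog ^^ t) (init_state enc ps)) \<and>
                  outputs ps ((step prog ^^ t) (init_state enc ps))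
                          (Sep (interior (polywin A b)) (set ps)))"
proof -
  let ?D = "CARD('d)"
  let ?W = "interior (polywin A b)"
  obtain cfgs :: "constraint list list" where
    valid: "\<And>cfg cn. cfg \<in> set cfgs \<Longrightarrow> cn \<in> set cfg \<Longrightarrow> valid ?D cn" and
    Sep: "\<And>ps. ps \<noteq> [] \<Longrightarrow> Sep ?W (set ps) =
      {{ps ! p | p. p < length ps \<and> (\<forall>cn\<in>set cfg. sat (\<lambda>k c. ps ! ((q(?D := p)) k) $ enc c) cn)}
        | cfg q. cfg \<in> set cfgs \<and> (\<forall>k<?D. q k < length ps)}"
    using Sep_eq_candidates[OF assms, of A b] by auto
  let ?code = "main_code ?D cfgs"
  let ?prog = "compile 0 ?code"
  define C where "C = (\<Sum>cfg\<leftarrow>cfgs. bits_time cfg + 17) + 18 * ?D + 27"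
  \<comment> \<open>\<open>wp\<close> speaks of memories only; \<open>p\<close> is a dummy program
    counter, which the output convention ignores.\<close>
  have run: "wp ?code (snd (init_state enc ps)) (C * (length ps + 1) ^ (?D + 1))
     (\<lambda>m. outputs ps (p, m) (Sep ?W (set ps)))" if ps: "distinct ps" for ps and p :: nat
  proof (cases "ps = []")
    case True
    have "Sep ?W {} = {{}}" by (simp add: Sep_def S_win_def)
    then have "wp ?code (snd (init_state enc ps)) (1 + 2) (\<lambda>m. outputs ps (p, m) (Sep ?W (set ps)))"
      unfolding main_code_def init_state_def True
      by (simp only: snd_conv, intro wp_cond wp_blockI) (simp_all add: outputs_def out_count_def out_set_def lessThan_Suc)
    then show ?thesis by (rule wp_mono) (simp_all add: True C_def)
  next
    case False
    define X where "X i c = ps ! i $ enc c" for i c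
    interpret cells ?D "length ps" X cfgs
      using False valid by unfold_locales auto
    have "i * ?D + c < length ps * ?D" if "i < length ps" "c < ?D" for i c
    proof -
      have "Suc i * ?D \<le> length ps * ?D" using that by (intro mult_right_mono) auto
      then show ?thesis using that by simp
    qed
    then have "wp ?code (snd (init_state enc ps)) ((walks_time + 18 * ?D + 27) * (length ps + 1) ^ (?D + 1))
        (\<lambda>m. represents allw m)"
      unfolding init_state_def snd_conv by (intro main_code_wp) (auto simp: X_def)
    then show ?thesis
    proof (rule wp_mono)
      fix m assume "represents allw m"
      then obtain I R ws where m: "m = (I, R)" "fixed I" "store ws I" "distinct ws" "set ws = allw"
        unfolding represents_def by (cases m) auto
      define f where "f w = {ps ! i | i. i < length ps \<and> w ! i}" for w
      have out: "out_set ps (p, m) k = f (ws ! k)" if "k < length ws" for k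
        using m(2,3) that unfolding out_set_def f_def m(1) fixed_def store_def by auto
      have count: "out_count (p, m) = length ws"
        using m(3) unfolding out_count_def m(1) store_def by simp
      \<comment> \<open>Distinct input points make different words denote different sets, so
        distinct rows give the required distinct outputs.\<close>
      have inj: "inj_on f allw"
      proof (rule inj_onI)
        fix v w assume vw: "v \<in> allw" "w \<in> allw" "f v = f w"
        have "ps ! i \<in> f u \<longleftrightarrow> u ! i" if "i < length ps" for i u
          using that ps unfolding f_def by (auto simp: nth_eq_iff_index_eq)
        then have "v ! i = w ! i" if "i < length ps" for i using that vw(3) by blast
        then show "v = w" using vw length_allw by (intro nth_equalityI) auto
      qed
      have "f (ws ! k) \<noteq> f (ws ! k')" if "k < length ws" "k' < length ws" "k \<noteq> k'" for k k'
      proof -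
        have "ws ! k \<in> allw" "ws ! k' \<in> allw" "ws ! k \<noteq> ws ! k'"
          using that m(4,5) nth_mem by (auto simp: nth_eq_iff_index_eq)
        then show ?thesis using inj_onD[OF inj] by blast
      qed
      moreover have "out_set ps (p, m) ` {..<length ws} = f ` allw"
      proof -
        have "out_set ps (p, m) ` {..<length ws} = f ` (\<lambda>k. ws ! k) ` {..<length ws}"
          unfolding image_image using out by (intro image_cong) auto
        also have "(\<lambda>k. ws ! k) ` {..<length ws} = allw"
          unfolding m(5)[symmetric] set_conv_nth by auto
        finally show ?thesis .
      qed
      moreover have "f ` allw = Sep ?W (set ps)"
      proof -
        have "f (word cfg q) = {ps ! i | i. i < length ps \<and> (\<forall>cn\<in>set cfg. sat (\<lambda>k c. ps ! ((q(?D := i)) k) $ enc c) cn)}"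
          for cfg q
          unfolding f_def using word_nth[of _ cfg q] by (auto simp: X_def[abs_def] simp del: fun_upd_apply)
        then have "f ` allw = {{ps ! p | p. p < length ps \<and> (\<forall>cn\<in>set cfg. sat (\<lambda>k c. ps ! ((q(?D := p)) k) $ enc c) cn)}
          | cfg q. cfg \<in> set cfgs \<and> (\<forall>k<?D. q k < length ps)}"
          unfolding allw_def by (auto simp del: fun_upd_apply) blast+
        then show ?thesis using Sep[OF False] by simp
      qed
      ultimately show "outputs ps (p, m) (Sep ?W (set ps))"
        unfolding outputs_def count using out by simp
    qed (simp add: C_def walks_time_def)
  qed
  have "\<exists>t. real t \<le> real C * real (length ps + 1) ^ (?D + 1) \<and>
      halted ?prog ((step ?prog ^^ t) (init_state enc ps)) \<and>
      outputs ps ((step ?prog ^^ t) (init_state enc ps)) (Sep ?W (set ps))" if ps: "distinct ps" for ps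
  proof -
    obtain t m where t: "t \<le> C * (length ps + 1) ^ (?D + 1)"
      "(step ?prog ^^ t) (0, snd (init_state enc ps)) = (length ?prog, m)"
      "outputs ps (length ?prog, m) (Sep ?W (set ps))"
      using wp_run[OF run[OF ps, of "length ?prog"]] by blast
    have "init_state enc ps = (0, snd (init_state enc ps))" by (simp add: init_state_def)
    moreover have "real t \<le> real C * real (length ps + 1) ^ (?D + 1)"
      using t(1) by (metis of_nat_le_iff of_nat_mult of_nat_power)
    ultimately show ?thesis using t(2,3) by (intro exI[of _ t]) (simp add: halted_def)
  qed
  then show ?thesis by blast
qed

end
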